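(* For every $\epsilon>0$ there exist $\delta>0$ and $p_0$ such that for every prime $p\geq p_0$ and every multiset $A$ of elements of $\mathbb{Z}_p^2$ in which no element has multiplicity $\geq\delta p$, the following hold: (1) if $|A|>(1+\epsilon)p$, then $A$ contains a non-empty sub-multiset of at most $p$ elements whose sum is $0$; (2) if $|A|>(2+\epsilon)p$, then $A$ contains a sub-multiset of exactly $p$ elements whose sum is $0$.
   Context: $\mathbb{Z}_p=\mathbb{Z}/p\mathbb{Z}$; sizes of multisets are counted with multiplicity. *)

theory Defs
  imports Complex_Main "HOL-Library.Multiset" "HOL-Number_Theory.Cong"
begin

text \<open>
  The group \<open>(\<int>/p\<int>)\<^sup>2\<close>, each residue class being represented by its least non-negative element,
  so that multiplicities of residue classes are multiplicities of elements of the carrier.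
\<close>

definition Zp2 :: "nat \<Rightarrow> (int \<times> int) set" where
  "Zp2 p = {0..<int p} \<times> {0..<int p}"

definition zero_sum :: "nat \<Rightarrow> (int \<times> int) multiset \<Rightarrow> bool" where
  "zero_sum p B \<longleftrightarrow>
     [(\<Sum>x\<in>#B. fst x) = 0] (mod int p) \<and> [(\<Sum>x\<in>#B. snd x) = 0] (mod int p)"

end

theory Submission
  imports Defs "HOL-Library.Product_Plus"
begin

text \<open>
  For a set \<open>Y\<close> in a finite abelian group the gain \<open>|(Y + d) - Y|\<close> is subadditive in \<open>d\<close>, and adding a
  pair \<open>{a, b}\<close> to a reservoir enlarges its set \<open>Y\<close> of sums of fixed length by the gain of \<open>Y\<close> at \<open>a - b\<close>.
  If no fibre of a nontrivial character carries a large share of the reservoir, averaging over the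
  multiples \<open>r (a - b)\<close> on the Fourier side produces a pair of gain at least \<open>K |Y| / p\<close> with a large
  constant \<open>K\<close>, so few pairs suffice to cover the group by sums of a fixed length.

  Call a line rich if it contains at least \<open>\<eta> p\<close> elements of \<open>A\<close>. By the cyclic case, a few elements of a
  rich line have fixed-length sums covering a full coset of its direction. If two rich lines are not
  parallel, or if many elements of \<open>A\<close> avoid all rich lines, then a few elements of \<open>A\<close> have
  fixed-length sums covering the whole plane, and any further elements may be added.
  Otherwise almost all of \<open>A\<close> lies on boundedly many parallel lines. A sub-multiset whose sum vanishes
  in the transversal coordinate is found by the Erdos-Ginzburg-Ziv theorem, or as a union of short
  zero sums; some line contains many of its elements, and exchanging these for elements reserved on
  the same line makes the other coordinate vanish too.
\<close>

section \<open>Sums of fixed length in a finite quotient group\<close>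

text \<open>The obstacle is a logarithm. The Fourier argument yields gains of order M |Y| / p, so
  each pair multiplies |Y| only by a factor of order 1 + M / p; starting from one point this would
  cost about (p / M) log p pairs. Growth therefore has two phases. Up to a share \<theta> of the
  group G, elementary bounds are used: at least one new sum per pair in the cyclic group, and of
  order sqrt |Y| new sums in the plane, so that |Y| grows quadratically in the number of pairs.
  Beyond that share every Fourier gain is at least a constant times M |G| / p, so O(p / M) pairs
  pass half of G, and two disjoint reservoirs past one half cover G.

  Lengths are kept exact for two reasons: a sub-multiset of exactly p elements is wanted in the end,
  and on a line the transversal coordinate of a sum depends on its length alone, so an exchange of
  equally many elements leaves it unchanged.

  The constants depend on each other in the order \<epsilon>, M, richness threshold \<eta>, size
  \<rho> of the reserve on one line, multiplicity bound \<delta>.\<close>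

locale quotient_group =
  fixes rep :: "'a::ab_group_add \<Rightarrow> 'a"
  assumes rep_add_left: "rep (rep a + b) = rep (a + b)"
    and finite_range: "finite (range rep)"
begin

text \<open>The group is the set \<open>range rep\<close> of representatives inside a fixed type,
  since a type cannot depend on the modulus p. Its addition is \<open>rep (a + b)\<close>, and the
  cyclic group and the plane are both instances.\<close>

definition shift :: "'a \<Rightarrow> 'a set \<Rightarrow> 'a set" where
  "shift a Y = (\<lambda>y. rep (y + a)) ` Y"

definition gain :: "'a set \<Rightarrow> 'a \<Rightarrow> nat" where
  "gain Y a = card (shift a Y - Y)"

text \<open>The elements of \<open>R\<close> are arbitrary and only the sums are reduced. In use
  \<open>R\<close> has 2k elements, collected as k pairs of which one member each is chosen.\<close>

definition reach :: "nat \<Rightarrow> 'a multiset \<Rightarrow> 'a set" where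
  "reach k R = {rep (sum_mset B) | B. B \<subseteq># R \<and> size B = k}"

lemma rep_rep [simp]: "rep (rep a) = rep a"
  using rep_add_left[of a 0] by simp

lemma rep_add_right: "rep (a + rep b) = rep (a + b)"
  using rep_add_left[of b a] by (simp add: add.commute)

lemma rep_in_range: "y \<in> range rep \<Longrightarrow> rep y = y"
  by auto

lemma finite_subset_range: "Y \<subseteq> range rep \<Longrightarrow> finite Y"
  using finite_range finite_subset by blast

lemma rep_add_cancel:
  assumes "y \<in> range rep" "z \<in> range rep" "rep (y + a) = rep (z + a)"
  shows "y = z"
proof -
  have "rep (rep (y + a) + (- a)) = rep (rep (z + a) + (- a))"
    using assms(3) by simp
  then have "rep y = rep z"
    by (simp add: rep_add_left del: add_uminus_conv_diff)
  then show ?thesis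
    using assms(1,2) by (metis rep_in_range)
qed

lemma inj_on_shift: "Y \<subseteq> range rep \<Longrightarrow> inj_on (\<lambda>y. rep (y + a)) Y"
  by (rule inj_onI) (use rep_add_cancel in blast)

lemma card_shift: "Y \<subseteq> range rep \<Longrightarrow> card (shift a Y) = card Y"
  unfolding shift_def by (rule card_image) (rule inj_on_shift)

lemma shift_subset: "shift a Y \<subseteq> range rep"
  unfolding shift_def by auto

lemma shift_shift: "shift b (shift a Y) = shift (a + b) Y"
  unfolding shift_def by (simp add: image_image rep_add_left add.assoc)

lemma shift_zero:
  assumes "Y \<subseteq> range rep"
  shows "shift 0 Y = Y"
proof -
  have "shift 0 Y = id ` Y"
    unfolding shift_def
  proof (rule image_cong)
    fix y assume "y \<in> Y"
    then show "rep (y + 0) = id y"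
      using rep_in_range[OF subsetD[OF assms]] by simp
  qed simp
  then show ?thesis by simp
qed

lemma shift_rep: "shift (rep a) Y = shift a Y"
  unfolding shift_def by (simp add: rep_add_right)

lemma shift_Un: "shift a (Y \<union> Z) = shift a Y \<union> shift a Z"
  unfolding shift_def by auto

lemma gain_plus_card_inter:
  assumes "Y \<subseteq> range rep"
  shows "gain Y a + card (shift a Y \<inter> Y) = card Y"
proof -
  have "card (shift a Y) = card (shift a Y \<inter> Y) + card (shift a Y - Y)"
    by (rule card_Int_Diff) (rule finite_subset_range[OF shift_subset])
  then show ?thesis
    using card_shift[OF assms] by (simp add: gain_def)
qed

lemma gain_zero: "Y \<subseteq> range rep \<Longrightarrow> gain Y 0 = 0"
  by (simp add: gain_def shift_zero)

text \<open>A point that lies outside Y after the shift by \<open>a + b\<close> either had left Y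
  after the shift by \<open>a\<close>, or was still in Y and leaves with the shift by
  \<open>b\<close>.\<close>

lemma gain_add:
  assumes "Y \<subseteq> range rep"
  shows "gain Y (a + b) \<le> gain Y a + gain Y b"
proof -
  have "shift (a + b) Y - Y \<subseteq> shift b (shift a Y - Y) \<union> (shift b Y - Y)"
    unfolding shift_shift[symmetric] by (auto simp: shift_def)
  then have "gain Y (a + b) \<le> card (shift b (shift a Y - Y) \<union> (shift b Y - Y))"
    unfolding gain_def
    by (intro card_mono finite_subset_range) (use shift_subset in blast)+
  also have "\<dots> \<le> card (shift b (shift a Y - Y)) + card (shift b Y - Y)"
    by (rule card_Un_le)
  also have "card (shift b (shift a Y - Y)) = card (shift a Y - Y)"
    by (rule card_shift) (use shift_subset in blast)
  finally show ?thesis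
    unfolding gain_def .
qed

lemma gain_multiple:
  assumes "Y \<subseteq> range rep"
  shows "gain Y (\<Sum>i<r. a) \<le> r * gain Y a"
proof (induction r)
  case 0
  then show ?case by (simp add: gain_zero assms)
next
  case (Suc r)
  have "gain Y (\<Sum>i<Suc r. a) \<le> gain Y (\<Sum>i<r. a) + gain Y a"
    using gain_add[OF assms] by simp
  with Suc show ?case by simp
qed

text \<open>Double counting: e and z = y + e with y, z in Y are determined by the pair (y, z),
  because distinct elements of E represent distinct group elements.\<close>

lemma sum_card_inter_le:
  assumes "Y \<subseteq> range rep" "E \<subseteq> range rep"
  shows "(\<Sum>e\<in>E. card (shift e Y \<inter> Y)) \<le> card Y * card Y"
proof -
  have fin: "finite Y" "finite E"
    using assms finite_subset_range by blast+
  \<comment> \<open>The injection into Y \<times> Y sends (e, z) to (y, z), with y the unique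
    preimage of z under the shift by e.\<close>
  let ?f = "\<lambda>(e, z). (THE y. y \<in> Y \<and> rep (y + e) = z, z)"
  have the: "(THE y. y \<in> Y \<and> rep (y + e) = z) \<in> Y
     \<and> rep ((THE y. y \<in> Y \<and> rep (y + e) = z) + e) = z" if "z \<in> shift e Y" for e z
  proof -
    obtain y where y: "y \<in> Y" "rep (y + e) = z"
      using \<open>z \<in> shift e Y\<close> unfolding shift_def by auto
    have "\<exists>!y. y \<in> Y \<and> rep (y + e) = z"
    proof (rule ex1I)
      show "y \<in> Y \<and> rep (y + e) = z"
        using y by simp
      fix x assume "x \<in> Y \<and> rep (x + e) = z"
      then show "x = y"
        using y assms(1) by (intro rep_add_cancel[of x y e]) auto
    qed
    then show ?thesis
      by (rule theI')
  qed
  have "card (SIGMA e:E. shift e Y \<inter> Y) \<le> card (Y \<times> Y)"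
  proof (rule card_inj_on_le[of ?f])
    show "inj_on ?f (SIGMA e:E. shift e Y \<inter> Y)"
    proof (rule inj_onI, clarify)
      fix e z e' z'
      assume e: "e \<in> E" "e' \<in> E" and z: "z \<in> shift e Y" "z \<in> shift e' Y"
        and eq: "(THE y. y \<in> Y \<and> rep (y + e) = z) = (THE y. y \<in> Y \<and> rep (y + e') = z)"
      obtain y where "rep (y + e) = z" "rep (y + e') = z"
        using the[OF z(1)] the[OF z(2)] eq by metis
      then have "rep (e + y) = rep (e' + y)"
        by (simp add: add.commute)
      then have "e = e'"
        using e assms(2) by (intro rep_add_cancel[of e e' y]) auto
      then show "e = e' \<and> z = z" by simp
    qed
    show "?f ` (SIGMA e:E. shift e Y \<inter> Y) \<subseteq> Y \<times> Y"
      using the by auto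
  qed (use fin in auto)
  then show ?thesis
    using fin by (simp add: card_cartesian_product)
qed

text \<open>Some element of E has a gain at least |Y| - |Y|^2 / |E|. Once |E| is at least 2 |Y|,
  this is half of |Y|.\<close>

lemma gain_average:
  assumes "Y \<subseteq> range rep" "E \<subseteq> range rep" "\<And>e. e \<in> E \<Longrightarrow> gain Y e \<le> c"
  shows "card E * card Y \<le> card Y * card Y + card E * c"
proof -
  have "card E * card Y = (\<Sum>e\<in>E. gain Y e + card (shift e Y \<inter> Y))"
    by (simp add: gain_plus_card_inter assms(1))
  also have "\<dots> \<le> card E * c + card Y * card Y"
    using sum_card_inter_le[OF assms(1,2)] sum_bounded_above[of E "gain Y" c] assms(3)
    by (simp add: sum.distrib add_mono)
  finally show ?thesis by simp
qed

lemma card_two_shifts: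
  assumes "Y \<subseteq> range rep"
  shows "card (shift a Y \<union> shift b Y) = card Y + gain Y (a - b)"
proof -
  have "shift a Y \<union> shift b Y = shift b (shift (a - b) Y \<union> Y)"
    by (simp add: shift_Un shift_shift)
  then have "card (shift a Y \<union> shift b Y) = card (shift (a - b) Y \<union> Y)"
    using card_shift[of "shift (a - b) Y \<union> Y" b] assms shift_subset by simp
  also have "shift (a - b) Y \<union> Y = Y \<union> (shift (a - b) Y - Y)"
    by auto
  also have "card \<dots> = card Y + gain Y (a - b)"
    unfolding gain_def using assms shift_subset
    by (intro card_Un_disjoint finite_subset_range) blast+
  finally show ?thesis .
qed

section \<open>Growth of the sets of fixed-length sums\<close>

lemma reach_subset: "reach k R \<subseteq> range rep"
  unfolding reach_def by auto

lemma finite_reach: "finite (reach k R)"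
  using finite_subset_range reach_subset by blast

lemma reach_zero: "reach 0 R = {rep 0}"
  unfolding reach_def by auto

lemma reach_add:
  assumes "y \<in> reach k R" "z \<in> reach l Q"
  shows "rep (y + z) \<in> reach (k + l) (R + Q)"
proof -
  obtain B C where B: "y = rep (sum_mset B)" "B \<subseteq># R" "size B = k"
    and C: "z = rep (sum_mset C)" "C \<subseteq># Q" "size C = l"
    using assms unfolding reach_def by auto
  have "rep (y + z) = rep (sum_mset (B + C))"
    by (simp add: B C rep_add_left rep_add_right)
  moreover have "B + C \<subseteq># R + Q" "size (B + C) = k + l"
    using B C by (auto intro: subset_mset.add_mono)
  ultimately show ?thesis
    unfolding reach_def by blast
qed

lemma card_reach_add_pair:
  "card (reach k R) + gain (reach k R) (a - b) \<le> card (reach (Suc k) (R + {#a, b#}))"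
proof -
  have s: "shift c (reach k R) \<subseteq> reach (Suc k) (R + {#a, b#})" if "c = a \<or> c = b" for c
  proof -
    have "rep c \<in> reach 1 {#a, b#}"
      unfolding reach_def using that by (intro CollectI exI[of _ "{#c#}"]) auto
    from reach_add[OF _ this] have "rep (y + c) \<in> reach (Suc k) (R + {#a, b#})" if "y \<in> reach k R" for y
      using that by (simp add: rep_add_right)
    then show ?thesis
      unfolding shift_def by blast
  qed
  have "card (shift a (reach k R) \<union> shift b (reach k R)) \<le> card (reach (Suc k) (R + {#a, b#}))"
    by (rule card_mono[OF finite_reach]) (use s[of a] s[of b] in auto)
  then show ?thesis
    by (simp add: card_two_shifts reach_subset)
qed

text \<open>Pigeonhole: two sets whose sizes add up to more than the group satisfy that the first
  meets t minus the second, for every t.\<close>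

lemma reach_full:
  assumes "card (range rep) < card (reach k R) + card (reach l Q)"
  shows "reach (k + l) (R + Q) = range rep"
proof
  show "range rep \<subseteq> reach (k + l) (R + Q)"
  proof
    fix t assume t: "t \<in> range rep"
    let ?Z = "(\<lambda>z. rep (t - z)) ` reach l Q"
    have "inj_on (\<lambda>z. rep (t - z)) (reach l Q)"
    proof (rule inj_onI)
      fix z z' assume z: "z \<in> reach l Q" "z' \<in> reach l Q" and eq: "rep (t - z) = rep (t - z')"
      have "rep (rep (t - z) + (z + z' - t)) = rep (rep (t - z') + (z + z' - t))"
        using eq by simp
      then have "rep z' = rep z"
        by (simp add: rep_add_left)
      then show "z = z'"
        using z reach_subset rep_in_range by (metis subsetD)
    qed
    then have "card ?Z = card (reach l Q)"
      by (rule card_image)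
    have "reach k R \<inter> ?Z \<noteq> {}"
    proof
      assume "reach k R \<inter> ?Z = {}"
      then have "card (reach k R \<union> ?Z) = card (reach k R) + card ?Z"
        by (intro card_Un_disjoint) (auto intro: finite_reach)
      moreover have "card (reach k R \<union> ?Z) \<le> card (range rep)"
        by (rule card_mono[OF finite_range]) (use reach_subset in blast)
      ultimately show False
        using assms \<open>card ?Z = card (reach l Q)\<close> by simp
    qed
    then obtain z where z: "z \<in> reach l Q" "rep (t - z) \<in> reach k R"
      by auto
    have "rep (rep (t - z) + z) = t"
      using rep_in_range[OF t] by (simp add: rep_add_left)
    then show "t \<in> reach (k + l) (R + Q)"
      using reach_add[OF z(2,1)] by simp
  qed
qed (rule reach_subset)

text \<open>The function \<open>h\<close> is a schedule of lower bounds, to be maintained one pair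
  at a time. The step hypothesis is stated for every \<open>C\<close> that arises from
  \<open>A\<close> by removing at most 2S elements, since the pairs chosen so far are spent. It may
  assume that Y fills at most half of the group, because otherwise the goal is already
  reached.\<close>

lemma reach_grow:
  fixes h :: "nat \<Rightarrow> real"
  assumes start: "h 0 \<le> 1"
    and finish: "2 * h S > card (range rep)"
    and step: "\<And>s C Y. s < S \<Longrightarrow> C \<subseteq># A \<Longrightarrow> size A \<le> size C + 2 * S \<Longrightarrow> Y \<subseteq> range rep \<Longrightarrow> Y \<noteq> {} \<Longrightarrow>
       h s \<le> card Y \<Longrightarrow> 2 * card Y \<le> card (range rep) \<Longrightarrow>
       \<exists>a\<in>#C. \<exists>b\<in>#C. 0 < gain Y (a - b) \<and> h (Suc s) \<le> card Y + gain Y (a - b)"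
  shows "\<exists>k\<le>S. \<exists>R. R \<subseteq># A \<and> size R = 2 * k \<and> 2 * card (reach k R) > card (range rep)"
proof (rule ccontr)
  assume neg: "\<not> ?thesis"
  have "\<exists>R. R \<subseteq># A \<and> size R = 2 * s \<and> h s \<le> card (reach s R)" if "s \<le> S" for s
    using that
  proof (induction s)
    case 0
    show ?case
      using start by (intro exI[of _ "{#}"]) (simp add: reach_zero)
  next
    case (Suc s)
    then obtain R where R: "R \<subseteq># A" "size R = 2 * s" "h s \<le> card (reach s R)"
      by auto
    have ne: "reach s R \<noteq> {}"
    proof -
      obtain xs where xs: "mset xs = R"
        using ex_mset by blast
      have "mset (take s xs) \<subseteq># R"
        using xs by (metis append_take_drop_id mset_append mset_subset_eq_add_left)
      moreover have "size (mset (take s xs)) = s"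
        using xs R(2) by auto
      ultimately show ?thesis
        unfolding reach_def by blast
    qed
    have "2 * card (reach s R) \<le> card (range rep)"
      using neg R Suc.prems by (meson Suc_leD not_less)
    moreover have "size A \<le> size (A - R) + 2 * S"
      using R Suc.prems by (simp add: size_Diff_submset)
    ultimately obtain a b where ab: "a \<in># A - R" "b \<in># A - R" "0 < gain (reach s R) (a - b)"
        "h (Suc s) \<le> card (reach s R) + gain (reach s R) (a - b)"
      using step[of s "A - R" "reach s R"] R(3) ne reach_subset Suc.prems by auto
    \<comment> \<open>This is the purpose of the clause \<open>0 < gain\<close> in the step
      hypothesis: distinct elements of what is left form a pair that is a sub-multiset, whereas
      equal ones might be a single copy.\<close>
    have "a \<noteq> b"
      using ab(3) by (auto simp: gain_zero reach_subset)
    then have "{#a, b#} \<subseteq># A - R"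
      using ab(1,2) by (intro mset_subset_eqI) (auto simp: Suc_le_eq in_diff_count)
    then have "R + {#a, b#} \<subseteq># A"
      using R(1) by (metis subset_mset.le_diff_conv2 union_commute)
    moreover have "h (Suc s) \<le> card (reach (Suc s) (R + {#a, b#}))"
      using ab(4) card_reach_add_pair[of s R a b] by linarith
    ultimately show ?case
      using R(2) by (intro exI[of _ "R + {#a, b#}"]) simp
  qed
  then obtain R where "R \<subseteq># A" "size R = 2 * S" "h S \<le> card (reach S R)"
    by blast
  then show False
    using neg finish by force
qed

end

section \<open>Expansion by Fourier analysis\<close>

definition ec :: "nat \<Rightarrow> int \<Rightarrow> complex" where
  "ec p n = cis (2 * pi * of_int n / of_nat p)"

section \<open>Exponential sums modulo p\<close>

lemma ec_add: "ec p (m + n) = ec p m * ec p n"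
  by (simp add: ec_def cis_mult add_divide_distrib distrib_left)

lemma ec_zero [simp]: "ec p 0 = 1"
  by (simp add: ec_def)

lemma norm_ec [simp]: "norm (ec p n) = 1"
  by (simp add: ec_def)

lemma cnj_ec: "cnj (ec p n) = ec p (- n)"
  by (simp add: ec_def cis_cnj)

lemma ec_power: "ec p (int r * m) = ec p m ^ r"
  by (simp add: ec_def DeMoivre mult_ac)

lemma ec_multiple:
  assumes "p > 0"
  shows "ec p (int p * n) = 1"
proof -
  have "2 * pi * of_int (int p * n) / of_nat p = 2 * pi * of_int n"
    using assms by simp
  then show ?thesis
    unfolding ec_def by (simp add: cis_multiple_2pi)
qed

lemma ec_mod:
  assumes "p > 0"
  shows "ec p (n mod int p) = ec p n"
proof -
  have "ec p n = ec p (int p * (n div int p) + n mod int p)"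
    by simp
  also have "\<dots> = ec p (n mod int p)"
    unfolding ec_add by (simp add: ec_multiple assms)
  finally show ?thesis by simp
qed

text \<open>Choose n with n t between pi / 2 and pi. Then \<open>cis t ^ n\<close> has non-positive
  real part, so its distance to 1 is at least 1; by the geometric sum this distance is at most n
  times that of \<open>cis t\<close>, and 1 / n is at least t / pi.\<close>

lemma norm_one_minus_cis_ge:
  assumes "0 < t" "t \<le> pi"
  shows "t / pi \<le> norm (1 - cis t)"
proof -
  define n where "n = nat \<lceil>pi / (2 * t)\<rceil>"
  have pos: "0 < pi / (2 * t)"
    using assms by simp
  have n1: "real n \<ge> pi / (2 * t)"
    unfolding n_def by (rule real_nat_ceiling_ge)
  have n2: "real n < pi / (2 * t) + 1"
    unfolding n_def using pos by linarith
  have n0: "0 < n"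
    using n1 pos by (cases n) auto
  have lo: "pi / 2 \<le> real n * t"
    using n1 assms by (simp add: field_simps)
  have hi: "real n * t \<le> pi"
  proof (cases "t \<le> pi / 2")
    case True
    have "real n * t \<le> (pi / (2 * t) + 1) * t"
      using n2 assms by (intro mult_right_mono) auto
    also have "\<dots> = pi / 2 + t"
      using assms by (simp add: field_simps)
    finally show ?thesis
      using True by simp
  next
    case False
    then have "pi / (2 * t) < 1"
      using assms by (simp add: field_simps)
    then have "n \<le> 1"
      using n2 by linarith
    then show ?thesis
      using assms n0 by (simp add: le_Suc_eq)
  qed
  have "cos (real n * t) \<le> cos (pi / 2)"
    by (rule cos_monotone_0_pi_le) (use lo hi in auto)
  then have "1 \<le> Re (1 - cis t ^ n)"
    by (simp add: DeMoivre)
  also have "\<dots> \<le> norm (1 - cis t ^ n)"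
    by (rule complex_Re_le_cmod)
  also have "\<dots> = norm (1 - cis t) * norm (\<Sum>i<n. cis t ^ i)"
    by (simp add: one_diff_power_eq norm_mult)
  also have "\<dots> \<le> norm (1 - cis t) * (\<Sum>i<n. 1)"
    by (intro mult_left_mono sum_norm_le) (auto simp: norm_power)
  finally have "1 \<le> norm (1 - cis t) * real n"
    by simp
  also have "\<dots> \<le> norm (1 - cis t) * (pi / t)"
    using hi assms by (intro mult_left_mono) (auto simp: field_simps)
  finally show ?thesis
    using assms by (simp add: field_simps)
qed

text \<open>The hypothesis says that m has distance at least M from the multiples of p. Conjugation
  exchanges k and p - k, so k may be assumed to be at most p / 2, where the angle 2 pi k / p is at
  most pi.\<close>

lemma norm_one_minus_ec_ge:
  assumes p: "p > 0" and M: "0 < M" "int M \<le> m mod int p" "m mod int p \<le> int p - int M"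
  shows "2 * real M / real p \<le> norm (1 - ec p m)"
proof -
  have half: "2 * real M / real p \<le> norm (1 - ec p k)"
    if "int M \<le> k" "2 * k \<le> int p" for k
  proof -
    have "2 * pi * real_of_int k / real p \<le> pi"
      using that p by (simp add: field_simps)
    moreover have "0 < 2 * pi * real_of_int k / real p"
      using that p M by simp
    ultimately have "2 * pi * real_of_int k / real p / pi \<le> norm (1 - ec p k)"
      unfolding ec_def by (rule norm_one_minus_cis_ge[rotated])
    moreover have "2 * real M / real p \<le> 2 * pi * real_of_int k / real p / pi"
      using that p by (simp add: divide_right_mono)
    ultimately show ?thesis by linarith
  qed
  define k where "k = m mod int p"
  have k: "ec p m = ec p k"
    unfolding k_def by (simp add: ec_mod p)
  show ?thesis
  proof (cases "2 * k \<le> int p")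
    case True
    then show ?thesis
      using half[of k] M k k_def by simp
  next
    case False
    have "norm (1 - ec p k) = norm (cnj (1 - ec p k))"
      by (simp only: complex_mod_cnj)
    also have "\<dots> = norm (1 - ec p (- k))"
      by (simp add: cnj_ec)
    also have "ec p (- k) = ec p (int p * 1 + (- k))"
      unfolding ec_add by (simp only: ec_multiple[OF p] mult_1)
    also have "int p * 1 + (- k) = int p - k"
      by simp
    finally show ?thesis
      using half[of "int p - k"] False M(3) k k_def by simp
  qed
qed

text \<open>The closed form of the geometric sum has numerator of norm at most 2, whatever R is; the
  bound is therefore a real saving over the trivial bound R once R is large compared with p /
  M.\<close>

lemma norm_sum_ec_le:
  assumes p: "p > 0" and M: "0 < M" "int M \<le> m mod int p" "m mod int p \<le> int p - int M"
  shows "norm (\<Sum>r<R. ec p (int r * m)) \<le> real p / real M"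
proof -
  let ?S = "\<Sum>r<R. ec p m ^ r"
  have "2 * real M / real p * norm ?S \<le> norm (1 - ec p m) * norm ?S"
    by (intro mult_right_mono norm_one_minus_ec_ge assms) simp
  also have "\<dots> = norm (1 - ec p m ^ R)"
    by (simp add: one_diff_power_eq norm_mult)
  also have "\<dots> \<le> 2"
    using norm_triangle_ineq4[of 1 "ec p m ^ R"] by (simp add: norm_power)
  finally show ?thesis
    unfolding ec_power using p M(1) by (simp add: field_simps)
qed

lemma sum_ec_orthogonal:
  assumes p: "p > 0"
  shows "(\<Sum>u\<in>{0..<int p}. ec p (u * a)) = (if int p dvd a then of_nat p else 0)"
proof -
  have "(\<Sum>u\<in>{0..<int p}. ec p (u * a)) = (\<Sum>r<p. ec p a ^ r)"
    unfolding ec_power[symmetric]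
    by (rule sum.reindex_bij_witness[of _ int nat]) auto
  also have "\<dots> = (if int p dvd a then of_nat p else 0)"
  proof (cases "int p dvd a")
    case True
    then obtain b where "a = int p * b" ..
    then have "ec p a = 1"
      using ec_multiple[OF p] by simp
    then show ?thesis
      using True by simp
  next
    case False
    have m: "0 < a mod int p" "a mod int p < int p"
      using False p pos_mod_sign[of "int p" a] pos_mod_bound[of "int p" a]
      unfolding dvd_eq_mod_eq_0 by linarith+
    have "2 * real 1 / real p \<le> norm (1 - ec p a)"
      by (rule norm_one_minus_ec_ge) (use p m in auto)
    moreover have "0 < 2 * real 1 / real p"
      using p by simp
    ultimately have "1 - ec p a \<noteq> 0"
      by auto
    moreover have "(1 - ec p a) * (\<Sum>r<p. ec p a ^ r) = 1 - ec p a ^ p"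
      by (simp add: one_diff_power_eq)
    moreover have "ec p a ^ p = 1"
      using ec_multiple[OF p, of a] by (simp add: ec_power)
    ultimately show ?thesis
      using False by simp
  qed
  finally show ?thesis .
qed

text \<open>The characters are \<open>ec p (\<phi> \<chi> a)\<close>, indexed by X and given by
  additive integer-valued forms. Orthogonality summed over the characters is the property from which
  both inversion and Parseval follow.\<close>

locale character_group = quotient_group rep for rep :: "'a::ab_group_add \<Rightarrow> 'a" +
  fixes p :: nat and X :: "'x set" and triv :: 'x and \<phi> :: "'x \<Rightarrow> 'a \<Rightarrow> int"
  assumes p_pos: "p > 0"
    and finite_X: "finite X"
    and triv: "triv \<in> X" "\<phi> triv a = 0"
    and phi_add: "\<phi> \<chi> (a + b) = \<phi> \<chi> a + \<phi> \<chi> b"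
    and orthogonal: "(\<Sum>\<chi>\<in>X. ec p (\<phi> \<chi> a)) = (if rep a = rep 0 then of_nat (card (range rep)) else 0)"
begin

lemma phi_zero: "\<phi> \<chi> 0 = 0"
  using phi_add[of \<chi> 0 0] by simp

lemma phi_diff: "\<phi> \<chi> (a - b) = \<phi> \<chi> a - \<phi> \<chi> b"
  using phi_add[of \<chi> "a - b" b] by simp

lemma phi_multiple: "\<phi> \<chi> (\<Sum>i<(r::nat). a) = int r * \<phi> \<chi> a"
  by (induction r) (simp_all add: phi_zero phi_add algebra_simps)

definition fourier :: "'a set \<Rightarrow> 'x \<Rightarrow> complex" where
  "fourier Y \<chi> = (\<Sum>y\<in>Y. ec p (\<phi> \<chi> y))"

text \<open>The squared norm is a double sum over y and z in Y; after multiplication by the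
  character at a, orthogonality keeps exactly the terms with z = y + a in the group, so the right
  side is the autocorrelation of Y.\<close>

lemma fourier_inversion:
  assumes Y: "Y \<subseteq> range rep"
  shows "(\<Sum>\<chi>\<in>X. of_real ((norm (fourier Y \<chi>))\<^sup>2) * ec p (\<phi> \<chi> a))
    = of_nat (card (range rep) * card (shift a Y \<inter> Y))"
proof -
  let ?g = "card (range rep)"
  have fin: "finite Y"
    using Y by (rule finite_subset_range)
  have "of_real ((norm (fourier Y \<chi>))\<^sup>2) * ec p (\<phi> \<chi> a)
      = (\<Sum>y\<in>Y. \<Sum>z\<in>Y. ec p (\<phi> \<chi> (y + a - z)))" for \<chi>
  proof -
    have "of_real ((norm (fourier Y \<chi>))\<^sup>2) * ec p (\<phi> \<chi> a)
      = (\<Sum>y\<in>Y. ec p (\<phi> \<chi> y)) * (\<Sum>z\<in>Y. ec p (- \<phi> \<chi> z)) * ec p (\<phi> \<chi> a)"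
      unfolding complex_norm_square fourier_def by (simp add: cnj_ec)
    also have "\<dots> = (\<Sum>y\<in>Y. \<Sum>z\<in>Y. ec p (\<phi> \<chi> y) * ec p (- \<phi> \<chi> z) * ec p (\<phi> \<chi> a))"
      by (subst sum_product) (simp only: sum_distrib_right)
    also have "\<dots> = (\<Sum>y\<in>Y. \<Sum>z\<in>Y. ec p (\<phi> \<chi> (y + a - z)))"
      unfolding ec_add[symmetric] phi_diff phi_add by (simp add: algebra_simps)
    finally show ?thesis .
  qed
  then have "(\<Sum>\<chi>\<in>X. of_real ((norm (fourier Y \<chi>))\<^sup>2) * ec p (\<phi> \<chi> a))
     = (\<Sum>\<chi>\<in>X. \<Sum>y\<in>Y. \<Sum>z\<in>Y. ec p (\<phi> \<chi> (y + a - z)))"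
    by simp
  also have "\<dots> = (\<Sum>y\<in>Y. \<Sum>\<chi>\<in>X. \<Sum>z\<in>Y. ec p (\<phi> \<chi> (y + a - z)))"
    by (rule sum.swap)
  also have "\<dots> = (\<Sum>y\<in>Y. \<Sum>z\<in>Y. \<Sum>\<chi>\<in>X. ec p (\<phi> \<chi> (y + a - z)))"
    by (intro sum.cong refl sum.swap)
  also have "\<dots> = (\<Sum>y\<in>Y. \<Sum>z\<in>Y. if rep (y + a) = z then of_nat ?g else 0)"
  proof (intro sum.cong refl)
    fix y z assume z: "z \<in> Y"
    have zz: "rep z = z"
      by (rule rep_in_range) (use z Y in blast)
    have "rep (y + a - z) = rep 0 \<longleftrightarrow> rep (y + a) = z"
    proof
      assume "rep (y + a - z) = rep 0"
      then have "rep (rep (y + a - z) + z) = rep (rep 0 + z)"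
        by simp
      then show "rep (y + a) = z"
        unfolding rep_add_left by (simp add: zz)
    next
      assume "rep (y + a) = z"
      then have "rep (rep (y + a) + (- z)) = rep (z + (- z))"
        by simp
      then show "rep (y + a - z) = rep 0"
        unfolding rep_add_left by simp
    qed
    then show "(\<Sum>\<chi>\<in>X. ec p (\<phi> \<chi> (y + a - z))) = (if rep (y + a) = z then of_nat ?g else 0)"
      by (simp add: orthogonal)
  qed
  also have "\<dots> = (\<Sum>y\<in>Y. if rep (y + a) \<in> Y then of_nat ?g else 0)"
    using fin by simp
  also have "\<dots> = of_nat (?g * card {y \<in> Y. rep (y + a) \<in> Y})"
    using fin by (simp flip: sum.inter_filter)
  also have "card {y \<in> Y. rep (y + a) \<in> Y} = card ((\<lambda>y. rep (y + a)) ` {y \<in> Y. rep (y + a) \<in> Y})"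
    by (rule card_image[symmetric], rule inj_on_shift) (use Y in blast)
  also have "(\<lambda>y. rep (y + a)) ` {y \<in> Y. rep (y + a) \<in> Y} = shift a Y \<inter> Y"
    unfolding shift_def by auto
  finally show ?thesis .
qed

lemma parseval:
  assumes Y: "Y \<subseteq> range rep"
  shows "(\<Sum>\<chi>\<in>X. (norm (fourier Y \<chi>))\<^sup>2) = real (card (range rep)) * real (card Y)"
proof -
  have "complex_of_real (\<Sum>\<chi>\<in>X. (norm (fourier Y \<chi>))\<^sup>2) = of_nat (card (range rep) * card Y)"
    using fourier_inversion[OF Y, of 0] by (simp add: phi_zero shift_zero Y)
  also have "\<dots> = complex_of_real (real (card (range rep)) * real (card Y))"
    by simp
  finally show ?thesis
    by (simp only: of_real_eq_iff)
qed

text \<open>The average of \<open>|(Y + d) \<inter> Y|\<close> over the multiples \<open>d = r (x\<^sub>i - x\<^sub>j)\<close>, \<open>r < R\<close>, is bounded on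
  the Fourier side; subadditivity of the gain brings a large gain at some \<open>d\<close> back to a gain at some
  \<open>x\<^sub>i - x\<^sub>j\<close>.\<close>

lemma gain_from_character_sums:
  fixes xs :: "'a list"
  defines "n \<equiv> length xs"
  assumes n: "n > 0" and R: "R > 0" and Y: "Y \<subseteq> range rep"
    and S: "\<And>\<chi>. \<chi> \<in> X - {triv} \<Longrightarrow>
      norm (\<Sum>i<n. \<Sum>j<n. \<Sum>r<R. ec p (int r * \<phi> \<chi> (xs ! i - xs ! j))) \<le> (real n)\<^sup>2 * real R / 2"
  shows "\<exists>i<n. \<exists>j<n. (real (card Y) - (real (card Y))\<^sup>2 / real (card (range rep))) / 2
    \<le> real R * real (gain Y (xs ! i - xs ! j))"
proof (rule ccontr)
  define g where "g = card (range rep)"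
  define y where "y = real (card Y)"
  \<comment> \<open>\<open>y - y\<^sup>2 / g\<close> is the average gain of Y over all shifts in the
    group. With T equal to half of it, the upper bound obtained below equals exactly the strict
    lower bound.\<close>
  define T where "T = (y - y\<^sup>2 / real g) / 2"
  define d where "d i j = xs ! i - xs ! j" for i j
  define N where "N a = card (shift a Y \<inter> Y)" for a
  define K where "K = (real n)\<^sup>2 * real R"
  assume "\<not> ?thesis"
  then have small: "real R * real (gain Y (d i j)) < T" if "i < n" "j < n" for i j
    using that unfolding T_def y_def g_def d_def by (meson not_less)
  have g: "g > 0"
    unfolding g_def using finite_range by (simp add: card_gt_0_iff)
  have K: "K > 0"
    unfolding K_def using n R by simp
  let ?S = "\<lambda>\<chi>. \<Sum>i<n. \<Sum>j<n. \<Sum>r<R. ec p (int r * \<phi> \<chi> (d i j))"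
  have S_triv: "norm (?S triv) \<le> K"
    unfolding K_def by (simp add: triv norm_mult power2_eq_square)
  have entry: "y - T < real (N (\<Sum>k<r. d i j))" if "i < n" "j < n" "r < R" for i j r
  proof -
    have "real (gain Y (\<Sum>k<r. d i j)) \<le> real (r * gain Y (d i j))"
      by (simp only: of_nat_le_iff gain_multiple[OF Y])
    also have "\<dots> \<le> real R * real (gain Y (d i j))"
      using that by (simp add: mult_right_mono)
    also have "\<dots> < T"
      using small that by simp
    finally show ?thesis
      using gain_plus_card_inter[OF Y, of "\<Sum>k<r. d i j"] unfolding N_def y_def by linarith
  qed
  have "K * (y - T) = (\<Sum>i<n. \<Sum>j<n. \<Sum>r<R. y - T)"
    unfolding K_def by (simp add: power2_eq_square)
  also have "\<dots> < (\<Sum>i<n. \<Sum>j<n. \<Sum>r<R. real (N (\<Sum>k<r. d i j)))"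
    using n R by (intro sum_strict_mono entry) auto
  finally have "real g * (K * (y - T)) < real g * (\<Sum>i<n. \<Sum>j<n. \<Sum>r<R. real (N (\<Sum>k<r. d i j)))"
    using g by simp
  also have "\<dots> = norm (\<Sum>i<n. \<Sum>j<n. \<Sum>r<R. of_nat (g * N (\<Sum>k<r. d i j)) :: complex)"
  proof -
    have "(\<Sum>i<n. \<Sum>j<n. \<Sum>r<R. of_nat (g * N (\<Sum>k<r. d i j)) :: complex)
      = of_nat (g * (\<Sum>i<n. \<Sum>j<n. \<Sum>r<R. N (\<Sum>k<r. d i j)))"
      by (simp add: sum_distrib_left)
    then show ?thesis
      by (simp only: norm_of_nat) simp
  qed
  also have "(\<Sum>i<n. \<Sum>j<n. \<Sum>r<R. of_nat (g * N (\<Sum>k<r. d i j)) :: complex)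
    = (\<Sum>i<n. \<Sum>j<n. \<Sum>r<R. \<Sum>\<chi>\<in>X. of_real ((norm (fourier Y \<chi>))\<^sup>2) * ec p (int r * \<phi> \<chi> (d i j)))"
    unfolding g_def N_def fourier_inversion[OF Y, symmetric] phi_multiple ..
  also have "\<dots> = (\<Sum>\<chi>\<in>X. of_real ((norm (fourier Y \<chi>))\<^sup>2) * ?S \<chi>)"
    by (simp add: sum_distrib_left sum.swap[of _ _ X])
  also have "norm \<dots> \<le> (\<Sum>\<chi>\<in>X. (norm (fourier Y \<chi>))\<^sup>2 * norm (?S \<chi>))"
    by (rule sum_norm_le) (simp add: norm_mult norm_power)
  also have "\<dots> = (norm (fourier Y triv))\<^sup>2 * norm (?S triv)
      + (\<Sum>\<chi>\<in>X - {triv}. (norm (fourier Y \<chi>))\<^sup>2 * norm (?S \<chi>))"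
    using finite_X triv(1) by (rule sum.remove)
  also have "\<dots> \<le> (norm (fourier Y triv))\<^sup>2 * K + (\<Sum>\<chi>\<in>X - {triv}. (norm (fourier Y \<chi>))\<^sup>2 * (K / 2))"
    using S S_triv unfolding d_def K_def by (intro add_mono sum_mono mult_left_mono) auto
  \<comment> \<open>Half of the trivial term moves into the sum over the other characters; that sum
    then runs over all of X and Parseval evaluates it.\<close>
  also have "\<dots> = (norm (fourier Y triv))\<^sup>2 * (K / 2) + (\<Sum>\<chi>\<in>X. (norm (fourier Y \<chi>))\<^sup>2 * (K / 2))"
    using sum.remove[OF finite_X triv(1), of "\<lambda>\<chi>. (norm (fourier Y \<chi>))\<^sup>2 * (K / 2)"] by (simp add: field_simps)
  also have "\<dots> = y\<^sup>2 * (K / 2) + real g * y * (K / 2)"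
  proof -
    have "fourier Y triv = of_nat (card Y)"
      unfolding fourier_def by (simp add: triv)
    then show ?thesis
      unfolding sum_distrib_right[symmetric] parseval[OF Y] y_def g_def by simp
  qed
  also have "\<dots> = real g * (K * (y - T))"
    unfolding T_def using g by (simp add: field_simps power2_eq_square)
  finally show False
    by simp
qed

text \<open>For fixed i call j bad if the character value at the difference is within M of a
  multiple of p. Fewer than 2M residues are concerned, so at most 2 M \<kappa> \<le> n / 4 indices j
  are bad, and each contributes at most R. Every other j contributes at most p / M \<le> R / 4. Each
  row is thus at most n R / 2.\<close>

lemma character_sum_le:
  fixes xs :: "'a list"
  defines "n \<equiv> length xs"
  assumes fibre: "\<And>w. card {j. j < n \<and> \<phi> \<chi> (xs ! j) mod int p = w} \<le> \<kappa>"
    and M: "M > 0" "8 * M * \<kappa> \<le> n" and R: "4 * p \<le> M * R"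
  shows "norm (\<Sum>i<n. \<Sum>j<n. \<Sum>r<R. ec p (int r * \<phi> \<chi> (xs ! i - xs ! j))) \<le> (real n)\<^sup>2 * real R / 2"
proof -
  define m where "m i j = \<phi> \<chi> (xs ! i - xs ! j) mod int p" for i j
  define Bad where "Bad i = {j. j < n \<and> \<not> (int M \<le> m i j \<and> m i j \<le> int p - int M)}" for i
  let ?s = "\<lambda>i j. \<Sum>r<R. ec p (int r * \<phi> \<chi> (xs ! i - xs ! j))"
  have finB: "finite (Bad i)" for i
    unfolding Bad_def by simp
  have bad: "card (Bad i) \<le> 2 * M * \<kappa>" for i
  proof -
    have "Bad i \<subseteq> (\<Union>t\<in>{- int M<..<int M}. {j. j < n \<and> \<phi> \<chi> (xs ! j) mod int p = (\<phi> \<chi> (xs ! i) - t) mod int p})"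
    proof
      fix j assume j: "j \<in> Bad i"
      \<comment> \<open>The representative of the difference that lies strictly between -M and M; it
        names the fibre that contains the bad j.\<close>
      define t where "t = (if m i j < int M then m i j else m i j - int p)"
      have "0 \<le> m i j" "m i j < int p"
        unfolding m_def using p_pos by auto
      then have "t \<in> {- int M<..<int M}"
        using j unfolding Bad_def t_def by auto
      moreover have "t mod int p = (\<phi> \<chi> (xs ! i) - \<phi> \<chi> (xs ! j)) mod int p"
        unfolding t_def m_def phi_diff by simp
      then have "(\<phi> \<chi> (xs ! i) - t) mod int p = (\<phi> \<chi> (xs ! i) - (\<phi> \<chi> (xs ! i) - \<phi> \<chi> (xs ! j))) mod int p"
        by (rule mod_diff_cong[OF refl])
      then have "\<phi> \<chi> (xs ! j) mod int p = (\<phi> \<chi> (xs ! i) - t) mod int p"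
        by simp
      ultimately show "j \<in> (\<Union>t\<in>{- int M<..<int M}.
          {j. j < n \<and> \<phi> \<chi> (xs ! j) mod int p = (\<phi> \<chi> (xs ! i) - t) mod int p})"
        using j unfolding Bad_def by auto
    qed
    then have "card (Bad i) \<le> card (\<Union>t\<in>{- int M<..<int M}.
        {j. j < n \<and> \<phi> \<chi> (xs ! j) mod int p = (\<phi> \<chi> (xs ! i) - t) mod int p})"
      by (intro card_mono) auto
    also have "\<dots> \<le> (\<Sum>t\<in>{- int M<..<int M}. card {j. j < n \<and> \<phi> \<chi> (xs ! j) mod int p = (\<phi> \<chi> (xs ! i) - t) mod int p})"
      by (rule card_UN_le) simp
    also have "\<dots> \<le> (\<Sum>t\<in>{- int M<..<int M}. \<kappa>)"
      by (intro sum_mono fibre)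
    also have "\<dots> \<le> 2 * M * \<kappa>"
      by (simp add: nat_le_iff)
    finally show ?thesis .
  qed
  have good: "norm (?s i j) \<le> real R / 4" if "j < n" "j \<notin> Bad i" for i j
  proof -
    have "norm (?s i j) \<le> real p / real M"
      by (rule norm_sum_ec_le) (use that p_pos M in \<open>auto simp: Bad_def m_def\<close>)
    also have "\<dots> \<le> real R / 4"
    proof -
      have "4 * real p \<le> real M * real R"
        using R by (metis of_nat_le_iff of_nat_mult of_nat_numeral)
      then show ?thesis
        using M(1) by (simp add: field_simps)
    qed
    finally show ?thesis .
  qed
  have triv_bound: "norm (?s i j) \<le> real R" for i j
    using norm_sum[of "\<lambda>r. ec p (int r * \<phi> \<chi> (xs ! i - xs ! j))" "{..<R}"] by simp
  have row: "norm (\<Sum>j<n. ?s i j) \<le> real n * real R / 2" for i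
  proof -
    have sub: "Bad i \<subseteq> {..<n}"
      unfolding Bad_def by auto
    have "norm (\<Sum>j<n. ?s i j) \<le> (\<Sum>j<n. norm (?s i j))"
      by (rule norm_sum)
    also have "\<dots> = (\<Sum>j\<in>{..<n} - Bad i. norm (?s i j)) + (\<Sum>j\<in>Bad i. norm (?s i j))"
      by (rule sum.subset_diff[OF sub]) simp
    also have "\<dots> \<le> (\<Sum>j\<in>{..<n} - Bad i. real R / 4) + (\<Sum>j\<in>Bad i. real R)"
      by (intro add_mono sum_mono good triv_bound) auto
    also have "\<dots> \<le> (\<Sum>j<n. real R / 4) + real (card (Bad i)) * real R"
      by (intro add_mono sum_mono2) auto
    also have "\<dots> \<le> real n * (real R / 4) + (real n / 4) * real R"
    proof -
      have "4 * card (Bad i) \<le> n"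
        using bad[of i] M(2) by linarith
      then have "real (card (Bad i)) \<le> real n / 4"
        by simp
      then show ?thesis
        by (intro add_mono mult_right_mono) auto
    qed
    finally show ?thesis by (simp add: mult.commute)
  qed
  have "norm (\<Sum>i<n. \<Sum>j<n. ?s i j) \<le> (\<Sum>i<n. real n * real R / 2)"
    by (rule sum_norm_le) (rule row)
  then show ?thesis
    by (simp add: power2_eq_square)
qed

text \<open>When Y fills at most half of the group, the average gain
  \<open>y - y\<^sup>2 / g\<close> is at least y / 2. Half of that is y / 4, hence the factor
  \<open>4 * R\<close>.\<close>

lemma exists_large_gain:
  fixes C :: "'a multiset"
  assumes fibre: "\<And>\<chi> w. \<chi> \<in> X - {triv} \<Longrightarrow> size {#a \<in># C. \<phi> \<chi> a mod int p = w#} \<le> \<kappa>"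
    and C: "C \<noteq> {#}" and M: "M > 0" "8 * M * \<kappa> \<le> size C" and R: "4 * p \<le> M * R"
    and Y: "Y \<subseteq> range rep" "2 * card Y \<le> card (range rep)"
  shows "\<exists>a\<in>#C. \<exists>b\<in>#C. real (card Y) \<le> 4 * real R * real (gain Y (a - b))"
proof -
  obtain xs where xs: "mset xs = C"
    using ex_mset by blast
  have len: "length xs = size C"
    using xs by auto
  have "R > 0"
    using R p_pos M by (cases R) auto
  have fib: "card {j. j < length xs \<and> \<phi> \<chi> (xs ! j) mod int p = w} \<le> \<kappa>" if "\<chi> \<in> X - {triv}" for \<chi> w
  proof -
    have "size {#a \<in># mset xs. \<phi> \<chi> a mod int p = w#} = length (filter (\<lambda>a. \<phi> \<chi> a mod int p = w) xs)"
      by (simp flip: mset_filter)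
    then show ?thesis
      using fibre[OF that, of w] by (simp add: xs length_filter_conv_card)
  qed
  have "\<exists>i<length xs. \<exists>j<length xs.
     (real (card Y) - (real (card Y))\<^sup>2 / real (card (range rep))) / 2 \<le> real R * real (gain Y (xs ! i - xs ! j))"
  proof (rule gain_from_character_sums)
    show "length xs > 0"
      using C xs by auto
    fix \<chi> assume chi: "\<chi> \<in> X - {triv}"
    show "norm (\<Sum>i<length xs. \<Sum>j<length xs. \<Sum>r<R. ec p (int r * \<phi> \<chi> (xs ! i - xs ! j)))
      \<le> (real (length xs))\<^sup>2 * real R / 2"
      by (rule character_sum_le[of _ _ \<kappa> M]) (use fib[OF chi] M R len in auto)
  qed (use Y \<open>R > 0\<close> in auto)
  then obtain i j where ij: "i < length xs" "j < length xs"
    "(real (card Y) - (real (card Y))\<^sup>2 / real (card (range rep))) / 2 \<le> real R * real (gain Y (xs ! i - xs ! j))"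
    by blast
  have g: "real (card (range rep)) > 0"
    using finite_range by (simp add: card_gt_0_iff)
  have "2 * real (card Y) \<le> real (card (range rep))"
    using Y(2) by linarith
  then have "real (card Y) * (2 * real (card Y)) \<le> real (card Y) * real (card (range rep))"
    by (intro mult_left_mono) auto
  then have "(real (card Y))\<^sup>2 / real (card (range rep)) \<le> real (card Y) / 2"
    using g by (simp add: field_simps power2_eq_square)
  then have "real (card Y) \<le> 4 * real R * real (gain Y (xs ! i - xs ! j))"
    using ij(3) by (simp add: field_simps)
  moreover have "xs ! i \<in># C" "xs ! j \<in># C"
    using ij xs by auto
  ultimately show ?thesis by blast
qed

end

section \<open>Small multisets whose fixed-length sums cover the group\<close>

lemma size_filter_mset_mono: "C \<subseteq># A \<Longrightarrow> size (filter_mset P C) \<le> size (filter_mset P A)"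
  by (intro size_mset_mono multiset_filter_mono)

lemma filter_mset_mono_pred:
  assumes "\<And>a. P a \<Longrightarrow> Q a"
  shows "filter_mset P C \<subseteq># filter_mset Q C"
  by (rule mset_subset_eqI) (use assms in auto)

text \<open>The two phases put together: S steps along the given schedule \<open>h\<close>, then T
  steps with Fourier gains. One run uses at most 2(S + T) elements. A second run on the remainder
  gives a disjoint set past one half, hence the bound 4(S + T) on what may be missing from
  \<open>C\<close>.\<close>

lemma (in character_group) reach_cover_steps:
  fixes h :: "nat \<Rightarrow> real"
  assumes fibre: "\<And>\<chi> w. \<chi> \<in> X - {triv} \<Longrightarrow> size {#a \<in># A. \<phi> \<chi> a mod int p = w#} \<le> \<kappa>"
    and sizeA: "8 * M * \<kappa> + 4 * (S + T) \<le> size A" "4 * (S + T) < size A"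
    and M: "M > 0" "4 * p \<le> M * R"
    and h: "h 0 \<le> 1" "0 < h S"
    and T: "2 * real (card (range rep)) * real R \<le> real T * h S"
    and step: "\<And>s C Y. s < S \<Longrightarrow> C \<subseteq># A \<Longrightarrow> size A \<le> size C + 4 * (S + T) \<Longrightarrow> Y \<subseteq> range rep \<Longrightarrow> Y \<noteq> {} \<Longrightarrow>
       h s \<le> card Y \<Longrightarrow> 2 * card Y \<le> card (range rep) \<Longrightarrow>
       \<exists>a\<in>#C. \<exists>b\<in>#C. 0 < gain Y (a - b) \<and> h (Suc s) \<le> card Y + gain Y (a - b)"
  shows "\<exists>k\<le>2 * (S + T). \<exists>Q. Q \<subseteq># A \<and> size Q = 2 * k \<and> reach k Q = range rep"
proof -
  define q where "q = h S"
  \<comment> \<open>After step S the set has at least q elements, so each Fourier gain is at least q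
    / (4R), and linear growth suffices: the hypothesis on T says that T such gains amount to at
    least half of the group.\<close>
  define H where "H s = (if s \<le> S then h s else q + real (s - S) * (q / (4 * real R)))" for s
  have R: "R > 0"
    using M p_pos by (cases R) auto
  have q: "q > 0"
    using h(2) q_def by simp
  have half: "\<exists>k\<le>S + T. \<exists>Q. Q \<subseteq># B \<and> size Q = 2 * k \<and> 2 * card (reach k Q) > card (range rep)"
    if B: "B \<subseteq># A" "size A \<le> size B + 2 * (S + T)" for B
  proof (rule reach_grow[where h = H])
    show "H 0 \<le> 1"
      using h(1) by (simp add: H_def)
    have "H (S + T) = q + real T * (q / (4 * real R))"
      unfolding H_def q_def by auto
    moreover have "real (card (range rep)) / 2 \<le> real T * (q / (4 * real R))"
      using T R unfolding q_def by (simp add: field_simps)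
    ultimately show "2 * H (S + T) > card (range rep)"
      using q by simp
  next
    fix s C Y
    assume s: "s < S + T" and C: "C \<subseteq># B" "size B \<le> size C + 2 * (S + T)"
      and Y: "Y \<subseteq> range rep" "Y \<noteq> {}" "H s \<le> card Y" "2 * card Y \<le> card (range rep)"
    have CA: "C \<subseteq># A" "size A \<le> size C + 4 * (S + T)"
      using B C by (auto intro: subset_mset.order_trans)
    show "\<exists>a\<in>#C. \<exists>b\<in>#C. 0 < gain Y (a - b) \<and> H (Suc s) \<le> card Y + gain Y (a - b)"
    proof (cases "s < S")
      case True
      then show ?thesis
        using step[OF True CA Y(1,2)] Y(3,4) by (simp add: H_def)
    next
      case False
      have Hs: "H s = q + real (s - S) * (q / (4 * real R))"
        using False unfolding H_def q_def by auto
      have Hs': "H (Suc s) = H s + q / (4 * real R)"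
      proof -
        have "H (Suc s) = q + real (Suc s - S) * (q / (4 * real R))"
          using False by (simp add: H_def)
        moreover have "real (Suc s - S) = real (s - S) + 1"
          using False by simp
        ultimately show ?thesis
          unfolding Hs by (simp only: distrib_right mult_1 add.assoc)
      qed
      have "q \<le> H s"
        unfolding Hs using q R by simp
      have "\<exists>a\<in>#C. \<exists>b\<in>#C. real (card Y) \<le> 4 * real R * real (gain Y (a - b))"
      proof (rule exists_large_gain[where \<kappa> = \<kappa> and M = M])
        show "C \<noteq> {#}"
          using CA(2) sizeA by auto
        show "8 * M * \<kappa> \<le> size C"
          using CA(2) sizeA by linarith
        show "size {#a \<in># C. \<phi> \<chi> a mod int p = w#} \<le> \<kappa>" if "\<chi> \<in> X - {triv}" for \<chi> w
          using fibre[OF that, of w] size_filter_mset_mono[OF CA(1)] order_trans by blast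
      qed (use M Y in auto)
      then obtain a b where ab: "a \<in># C" "b \<in># C" "real (card Y) \<le> 4 * real R * real (gain Y (a - b))"
        by blast
      have "q / (4 * real R) \<le> real (gain Y (a - b))"
        using ab(3) Y(3) \<open>q \<le> H s\<close> R by (simp add: field_simps)
      moreover from this have "0 < gain Y (a - b)"
        using q R by (metis divide_pos_pos less_le_trans mult_pos_pos of_nat_0_less_iff zero_less_numeral)
      ultimately show ?thesis
        using ab(1,2) Y(3) Hs' by (intro bexI[of _ a] bexI[of _ b]) auto
    qed
  qed
  obtain k Q where k: "k \<le> S + T" and Q: "Q \<subseteq># A" "size Q = 2 * k" "2 * card (reach k Q) > card (range rep)"
    using half[of A] by auto
  \<comment> \<open>Second run, on the elements that the first one left over.\<close>
  have "A - Q \<subseteq># A" "size A \<le> size (A - Q) + 2 * (S + T)"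
    using Q k by (auto simp: size_Diff_submset)
  then obtain l P where l: "l \<le> S + T" and P: "P \<subseteq># A - Q" "size P = 2 * l" "2 * card (reach l P) > card (range rep)"
    using half[of "A - Q"] by auto
  have "reach (k + l) (Q + P) = range rep"
    using Q(3) P(3) by (intro reach_full) linarith
  moreover have "Q + P \<subseteq># A"
    using Q(1) P(1) by (metis subset_mset.le_diff_conv2 union_commute)
  ultimately show ?thesis
    using Q(2) P(2) k l by (intro exI[of _ "k + l"] exI[of _ "Q + P"] conjI) auto
qed

text \<open>The same with everything measured in multiples of p: R and T are computed here, and the
  budget is 4(S + T) \<le> r p / 2. The elementary phase has to reach the share \<theta> of the
  group within S \<le> r p / 32 steps.\<close>

lemma (in character_group) reach_cover:
  fixes h :: "nat \<Rightarrow> real" and r \<theta> :: real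
  assumes fibre: "\<And>\<chi> w. \<chi> \<in> X - {triv} \<Longrightarrow> real (size {#a \<in># A. \<phi> \<chi> a mod int p = w#}) \<le> \<kappa>"
    and sizeA: "8 * real M * \<kappa> + r * real p / 2 \<le> size A" "r * real p / 2 < size A"
    and r: "r > 0" "32 \<le> r * real p" "real S \<le> r * real p / 32"
    and \<theta>: "\<theta> > 0" "\<theta> * real (card (range rep)) \<le> h S"
    and M: "320 / (\<theta> * r) \<le> real M" "M \<le> p"
    and h: "h 0 \<le> 1"
    and step: "\<And>s C Y. s < S \<Longrightarrow> C \<subseteq># A \<Longrightarrow> size A \<le> size C + r * real p / 2 \<Longrightarrow> Y \<subseteq> range rep \<Longrightarrow> Y \<noteq> {} \<Longrightarrow>
       h s \<le> card Y \<Longrightarrow> 2 * card Y \<le> card (range rep) \<Longrightarrow>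
       \<exists>a\<in>#C. \<exists>b\<in>#C. 0 < gain Y (a - b) \<and> h (Suc s) \<le> card Y + gain Y (a - b)"
  shows "\<exists>k Q. Q \<subseteq># A \<and> size Q = 2 * k \<and> real (size Q) \<le> r * real p \<and> reach k Q = range rep"
proof -
  have "0 < 320 / (\<theta> * r)"
    using \<theta> r by simp
  then have M0: "M > 0"
    using M(1) by (cases M) auto
  \<comment> \<open>The least R with 4p \<le> M R. Since M \<le> p, rounding up costs at most a
    factor 5 / 4, so R \<le> 5 p / M.\<close>
  define R where "R = nat \<lceil>4 * real p / real M\<rceil>"
  have R1: "4 * real p / real M \<le> real R"
    unfolding R_def by (rule real_nat_ceiling_ge)
  have "0 \<le> 4 * real p / real M"
    by simp
  then have R2: "real R \<le> 4 * real p / real M + 1"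
    unfolding R_def by linarith
  have "1 \<le> real p / real M"
    using M M0 by simp
  then have R3: "real R \<le> 5 * (real p / real M)"
    using R2 by simp
  define T where "T = nat \<lceil>2 * real R / \<theta>\<rceil>"
  have T1: "2 * real R / \<theta> \<le> real T"
    unfolding T_def by (rule real_nat_ceiling_ge)
  have "0 \<le> 2 * real R / \<theta>"
    using \<theta> by simp
  then have T2: "real T \<le> 2 * real R / \<theta> + 1"
    unfolding T_def by linarith
  have "2 * real R / \<theta> \<le> 2 * (5 * (real p / real M)) / \<theta>"
    using R3 \<theta> by (intro divide_right_mono) auto
  also have "\<dots> = 10 * real p / (\<theta> * real M)"
    using M0 \<theta> by (simp add: field_simps)
  \<comment> \<open>Origin of 320 = 10 * 32: T is about 2 R / \<theta> \<le> 10 p / (\<theta> M),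
    and a share r p / 32 is allotted to it.\<close>
  also have "\<dots> \<le> r * real p / 32"
  proof -
    have "320 \<le> real M * (\<theta> * r)"
      using M(1) \<theta> r by (simp add: field_simps)
    then have "320 * real p \<le> real M * (\<theta> * r) * real p"
      by (intro mult_right_mono) auto
    then show ?thesis
      using M0 \<theta>(1) by (simp add: field_simps)
  qed
  finally have ST: "4 * (real S + real T) \<le> r * real p / 2"
    using T2 r by simp
  \<comment> \<open>The maximum with 0 is taken because \<open>fibre\<close> does not force \<kappa>
    to be non-negative when there is no nontrivial character.\<close>
  define \<kappa>' where "\<kappa>' = nat \<lfloor>max 0 \<kappa>\<rfloor>"
  have fib: "size {#a \<in># A. \<phi> \<chi> a mod int p = w#} \<le> \<kappa>'" if "\<chi> \<in> X - {triv}" for \<chi> w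
    using fibre[OF that, of w] unfolding \<kappa>'_def by (simp add: le_nat_floor)
  have g: "card (range rep) > 0"
    using finite_range by (simp add: card_gt_0_iff)
  have hS: "0 < h S"
    using \<theta> g by (meson less_le_trans mult_pos_pos of_nat_0_less_iff)
  have kap: "real \<kappa>' = 0 \<or> real \<kappa>' \<le> \<kappa>"
    unfolding \<kappa>'_def by linarith
  have "8 * real M * real \<kappa>' + 4 * (real S + real T) \<le> real (size A)"
  proof (cases "real \<kappa>' = 0")
    case True
    then show ?thesis
      using ST sizeA(2) by simp
  next
    case False
    then have "8 * real M * real \<kappa>' \<le> 8 * real M * \<kappa>"
      using kap by (intro mult_left_mono) auto
    then show ?thesis
      using ST sizeA(1) by linarith
  qed
  then have "real (8 * M * \<kappa>' + 4 * (S + T)) \<le> real (size A)"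
    by simp
  then have s1: "8 * M * \<kappa>' + 4 * (S + T) \<le> size A"
    by (simp only: of_nat_le_iff)
  have "real (4 * (S + T)) < real (size A)"
    using ST sizeA(2) by simp
  then have s2: "4 * (S + T) < size A"
    by (simp only: of_nat_less_iff)
  have "4 * real p \<le> real M * real R"
    using R1 M0 by (simp add: field_simps)
  then have mr: "4 * p \<le> M * R"
    by (metis of_nat_le_iff of_nat_mult of_nat_numeral)
  have "2 * real (card (range rep)) * real R = (2 * real R / \<theta>) * (\<theta> * real (card (range rep)))"
    using \<theta> by (simp add: field_simps)
  also have "\<dots> \<le> real T * h S"
    using T1 \<theta> by (intro mult_mono) auto
  finally have hT: "2 * real (card (range rep)) * real R \<le> real T * h S" .
  have "\<exists>k\<le>2 * (S + T). \<exists>Q. Q \<subseteq># A \<and> size Q = 2 * k \<and> reach k Q = range rep"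
  proof (rule reach_cover_steps[OF fib s1 s2 M0 mr h hS hT])
    fix s C Y
    assume "s < S" "C \<subseteq># A" and sz: "size A \<le> size C + 4 * (S + T)" and "Y \<subseteq> range rep" "Y \<noteq> {}"
      "h s \<le> card Y" "2 * card Y \<le> card (range rep)"
    moreover have "real (size A) \<le> real (size C) + r * real p / 2"
    proof -
      have "real (size A) \<le> real (size C) + 4 * (real S + real T)"
        using sz by (metis of_nat_add of_nat_le_iff of_nat_mult of_nat_numeral)
      then show ?thesis
        using ST by linarith
    qed
    ultimately show "\<exists>a\<in>#C. \<exists>b\<in>#C. 0 < gain Y (a - b) \<and> h (Suc s) \<le> card Y + gain Y (a - b)"
      by (intro step)
  qed
  then obtain k Q where k: "k \<le> 2 * (S + T)" "Q \<subseteq># A" "size Q = 2 * k" "reach k Q = range rep"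
    by blast
  have "real (size Q) \<le> 4 * (real S + real T)"
    using k by simp
  then have "real (size Q) \<le> r * real p"
    using ST r(2) by linarith
  then show ?thesis
    using k by blast
qed

subsection \<open>The cyclic group of prime order\<close>

lemma range_mod_int: "p > 0 \<Longrightarrow> range (\<lambda>x. x mod int p) = {0..<int p}"
proof (intro equalityI subsetI)
  fix x assume "p > 0" "x \<in> {0..<int p}"
  then have "x = x mod int p"
    by simp
  then show "x \<in> range (\<lambda>x. x mod int p)"
    by blast
qed auto

lemma character_group_int:
  assumes p: "p > 0"
  shows "character_group (\<lambda>x. x mod int p) p {0..<int p} 0 (\<lambda>u a. u * a)"
proof
  fix a :: int
  show "(\<Sum>\<chi>\<in>{0..<int p}. ec p (\<chi> * a))
    = (if a mod int p = 0 mod int p then of_nat (card (range (\<lambda>x. x mod int p))) else 0)"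
    using sum_ec_orthogonal[OF p, of a] by (simp add: range_mod_int p dvd_eq_mod_eq_0)
qed (use p in \<open>auto simp: range_mod_int mod_simps algebra_simps\<close>)

lemma exists_mult_cong:
  fixes d :: int
  assumes "prime p" "\<not> int p dvd d"
  shows "\<exists>r::nat. [int r * d = t] (mod int p)"
proof -
  have "coprime d (int p)"
    using assms by (metis coprime_commute prime_imp_coprime prime_nat_int_transfer)
  then obtain e where e: "[d * e = 1] (mod int p)"
    using cong_solve_coprime_int by blast
  define r where "r = nat ((e * t) mod int p)"
  have "int r = (e * t) mod int p"
    unfolding r_def using assms(1) by (simp add: prime_gt_0_nat)
  then have "[int r * d = e * t * d] (mod int p)"
    by (simp add: cong_def mod_simps)
  moreover have "[e * t * d = d * e * t] (mod int p)"
    by (simp add: mult_ac)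
  moreover have "[d * e * t = 1 * t] (mod int p)"
    using e by (rule cong_scalar_right)
  ultimately show ?thesis
    by (metis cong_trans mult_1)
qed

text \<open>Gain 0 at d means gain 0 at all multiples of d, by subadditivity. These multiples are
  the whole group, so a non-empty Y with this property would be everything.\<close>

lemma gain_pos_int:
  assumes p: "prime p" and Y: "Y \<subseteq> {0..<int p}" "Y \<noteq> {}" "card Y < p" and d: "\<not> int p dvd d"
  shows "0 < quotient_group.gain (\<lambda>x. x mod int p) Y d"
proof (rule ccontr)
  have p0: "p > 0"
    using p by (rule prime_gt_0_nat)
  interpret character_group "\<lambda>x. x mod int p" p "{0..<int p}" 0 "\<lambda>u a. u * a"
    by (rule character_group_int[OF p0])
  have Yr: "Y \<subseteq> range (\<lambda>x. x mod int p)"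
    using Y p0 by (simp add: range_mod_int)
  assume "\<not> 0 < gain Y d"
  then have "gain Y (\<Sum>i<r. d) = 0" for r :: nat
    using gain_multiple[OF Yr, of d r] by simp
  then have sub: "shift (int r * d) Y \<subseteq> Y" for r :: nat
    unfolding gain_def using finite_subset_range[OF shift_subset] by simp
  obtain y where y: "y \<in> Y"
    using Y by auto
  have "{0..<int p} \<subseteq> Y"
  proof
    fix t assume t: "t \<in> {0..<int p}"
    obtain r :: nat where "[int r * d = t - y] (mod int p)"
      using exists_mult_cong[OF p d] by blast
    then have "(y + int r * d) mod int p = t mod int p"
      by (metis cong_def add_diff_cancel_left' cong_add_lcancel add.commute diff_add_cancel)
    then have "(y + int r * d) mod int p = t"
      using t by simp
    then have "t \<in> shift (int r * d) Y"
      using y unfolding shift_def by blast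
    then show "t \<in> Y"
      using sub by blast
  qed
  then have "p \<le> card Y"
    using card_mono[of Y "{0..<int p}"] Y(1) finite_subset by fastforce
  then show False
    using Y by simp
qed

text \<open>A fibre of a nontrivial character of a cyclic group of prime order is a single residue
  class, so the fibre condition is the bound on multiplicities. The same bound guarantees two
  different residues among the elements left, which makes every step of the elementary phase gain at
  least 1.\<close>

lemma cyclic_cover:
  fixes \<eta> \<rho> :: real
  assumes \<eta>: "\<eta> > 0" and \<rho>: "\<rho> > 0"
  shows "\<exists>\<delta>>0. \<exists>p0. \<forall>p\<ge>p0. prime p \<longrightarrow> (\<forall>C :: int multiset.
    \<eta> * real p \<le> size C \<and> (\<forall>w. real (size {#c \<in># C. c mod int p = w#}) \<le> \<delta> * real p) \<longrightarrow>
    (\<exists>k R. R \<subseteq># C \<and> size R = 2 * k \<and> real (size R) \<le> \<rho> * real p \<and>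
      (\<forall>t. \<exists>B. B \<subseteq># R \<and> size B = k \<and> [sum_mset B = t] (mod int p))))"
proof -
  define r where "r = min \<rho> \<eta>"
  have r: "r > 0" "r \<le> \<rho>" "r \<le> \<eta>"
    using \<eta> \<rho> by (auto simp: r_def)
  \<comment> \<open>After S = floor(r p / 32) elementary steps there are at least S + 1 \<ge> r p /
    32 sums.\<close>
  define \<theta> where "\<theta> = r / 32"
  have \<theta>: "\<theta> > 0"
    using r by (simp add: \<theta>_def)
  define M where "M = Suc (nat \<lceil>320 / (\<theta> * r)\<rceil>)"
  have M: "320 / (\<theta> * r) \<le> real M" "M > 0"
    unfolding M_def using real_nat_ceiling_ge[of "320 / (\<theta> * r)"] by linarith+
  \<comment> \<open>Makes 8 M \<delta> p equal to \<eta> p / 2; the other half of \<eta> p pays for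
    the elements used up, at most r p / 2 of them.\<close>
  define \<delta> where "\<delta> = \<eta> / (16 * real M)"
  have \<delta>: "\<delta> > 0"
    using M \<eta> by (simp add: \<delta>_def)
  define p0 where "p0 = max M (nat \<lceil>32 / r\<rceil>)"
  have "\<exists>k R. R \<subseteq># C \<and> size R = 2 * k \<and> real (size R) \<le> \<rho> * real p \<and>
      (\<forall>t. \<exists>B. B \<subseteq># R \<and> size B = k \<and> [sum_mset B = t] (mod int p))"
    if pp: "p \<ge> p0" "prime p" and C: "\<eta> * real p \<le> size C"
      and fib: "\<forall>w. real (size {#c \<in># C. c mod int p = w#}) \<le> \<delta> * real p"
    for p and C :: "int multiset"
  proof -
    have p: "p > 0"
      using pp(2) by (rule prime_gt_0_nat)
    interpret character_group "\<lambda>x. x mod int p" p "{0..<int p}" 0 "\<lambda>u a. u * a"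
      by (rule character_group_int[OF p])
    have card_range: "card (range (\<lambda>x. x mod int p)) = p"
      by (simp add: range_mod_int p)
    have "M \<le> p" "nat \<lceil>32 / r\<rceil> \<le> p"
      using pp by (auto simp: p0_def)
    then have "32 / r \<le> real p"
      by linarith
    then have rp: "32 \<le> r * real p"
      using r by (simp add: field_simps)
    define S where "S = nat \<lfloor>r * real p / 32\<rfloor>"
    have S: "real S \<le> r * real p / 32" "r * real p / 32 \<le> real S + 1"
      unfolding S_def using rp by linarith+
    have Mk: "8 * real M * (\<delta> * real p) = \<eta> * real p / 2"
      using M by (simp add: \<delta>_def)
    have rpe: "r * real p \<le> \<eta> * real p"
      using r by (intro mult_right_mono) auto
    have ep: "0 < \<eta> * real p" "0 < \<delta> * real p"
      using \<eta> \<delta> p by auto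
    have "1 * (\<delta> * real p) \<le> 8 * real M * (\<delta> * real p)"
      using M(2) ep by (intro mult_right_mono) linarith+
    moreover have "1 * (\<delta> * real p) \<noteq> 8 * real M * (\<delta> * real p)"
      using M(2) ep p by auto
    ultimately have dsmall: "\<delta> * real p < \<eta> * real p / 2"
      using Mk by linarith
    have "\<exists>k Q. Q \<subseteq># C \<and> size Q = 2 * k \<and> real (size Q) \<le> r * real p \<and> reach k Q = range (\<lambda>x. x mod int p)"
    proof (rule reach_cover[where h = "\<lambda>s. real s + 1" and \<kappa> = "\<delta> * real p" and M = M and \<theta> = \<theta> and S = S])
      fix \<chi> w :: int
      assume chi: "\<chi> \<in> {0..<int p} - {0}"
      have "\<not> int p dvd \<chi>"
        using chi zdvd_not_zless[of \<chi> "int p"] by auto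
      then obtain e :: nat where e: "[int e * \<chi> = 1] (mod int p)"
        using exists_mult_cong[OF pp(2)] by blast
      have "{#a \<in># C. \<chi> * a mod int p = w#} \<subseteq># {#a \<in># C. a mod int p = (int e * w) mod int p#}"
      proof (rule filter_mset_mono_pred)
        fix a assume "\<chi> * a mod int p = w"
        then have "(int e * w) mod int p = (int e * \<chi> * a) mod int p"
          by (auto simp: mod_simps mult.assoc)
        also have "\<dots> = a mod int p"
          using cong_scalar_right[OF e, of a] by (simp add: cong_def)
        finally show "a mod int p = (int e * w) mod int p" ..
      qed
      then show "real (size {#a \<in># C. \<chi> * a mod int p = w#}) \<le> \<delta> * real p"
        using fib by (meson of_nat_le_iff order_trans size_mset_mono)
    next
      show "8 * real M * (\<delta> * real p) + r * real p / 2 \<le> real (size C)"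
        using Mk C rpe by linarith
      show "r * real p / 2 < real (size C)"
        using C rpe ep by linarith
      show "\<theta> * real (card (range (\<lambda>x. x mod int p))) \<le> real S + 1"
        unfolding card_range \<theta>_def using S by simp
    next
      fix s D and Y :: "int set"
      assume D: "D \<subseteq># C" "real (size C) \<le> real (size D) + r * real p / 2"
        and Y: "Y \<subseteq> range (\<lambda>x. x mod int p)" "Y \<noteq> {}" "real s + 1 \<le> real (card Y)"
          "2 * card Y \<le> card (range (\<lambda>x. x mod int p))"
      have "real (size D) \<ge> \<eta> * real p / 2"
        using D(2) C rpe by linarith
      then have Dbig: "real (size D) > \<delta> * real p"
        using dsmall by linarith
      then have "size D > 0"
        using ep by (metis gr0I less_asym of_nat_0)
      then obtain b where b: "b \<in># D"
        by (metis multiset_nonemptyE nonempty_has_size)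
      have "\<exists>a\<in>#D. a mod int p \<noteq> b mod int p"
      proof (rule ccontr)
        assume "\<not> ?thesis"
        then have "{#c \<in># D. c mod int p = b mod int p#} = D"
          by (simp add: filter_mset_eq_conv)
        then have "size D \<le> size {#c \<in># C. c mod int p = b mod int p#}"
          using size_filter_mset_mono[OF D(1), of "\<lambda>c. c mod int p = b mod int p"] by simp
        then show False
          using fib Dbig by (meson le_less_trans less_irrefl of_nat_le_iff order_trans)
      qed
      then obtain a where a: "a \<in># D" "a mod int p \<noteq> b mod int p"
        by blast
      have "0 < gain Y (a - b)"
      proof (rule gain_pos_int[OF pp(2)])
        show "Y \<subseteq> {0..<int p}"
          using Y(1) p by (simp add: range_mod_int)
        show "card Y < p"
          using Y(4) p unfolding card_range by linarith
        show "\<not> int p dvd a - b"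
          using a(2) by (simp add: mod_eq_dvd_iff)
      qed (rule Y(2))
      then show "\<exists>a\<in>#D. \<exists>b\<in>#D. 0 < gain Y (a - b) \<and> real (Suc s) + 1 \<le> real (card Y + gain Y (a - b))"
        using a b Y(3) by (intro bexI[of _ a] bexI[of _ b]) auto
    qed (use r rp S \<theta> M \<open>M \<le> p\<close> in auto)
    then obtain k Q where Q: "Q \<subseteq># C" "size Q = 2 * k" "real (size Q) \<le> r * real p"
      and reach: "reach k Q = range (\<lambda>x. x mod int p)"
      by blast
    have "\<exists>B. B \<subseteq># Q \<and> size B = k \<and> [sum_mset B = t] (mod int p)" for t
    proof -
      have "t mod int p \<in> reach k Q"
        unfolding reach by blast
      then show ?thesis
        unfolding reach_def cong_def by fastforce
    qed
    moreover have "r * real p \<le> \<rho> * real p"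
      using r by (intro mult_right_mono) auto
    ultimately show ?thesis
      using Q order_trans by blast
  qed
  then show ?thesis
    using \<delta> by blast
qed

subsection \<open>The plane over a prime field\<close>

definition rep2 :: "nat \<Rightarrow> int \<times> int \<Rightarrow> int \<times> int" where
  "rep2 p a = (fst a mod int p, snd a mod int p)"

definition lin :: "int \<times> int \<Rightarrow> int \<times> int \<Rightarrow> int" where
  "lin u a = fst u * fst a + snd u * snd a"

lemma lin_add: "lin u (a + b) = lin u a + lin u b"
  by (simp add: lin_def algebra_simps)

lemma range_rep2:
  assumes "p > 0"
  shows "range (rep2 p) = {0..<int p} \<times> {0..<int p}"
proof (intro equalityI subsetI)
  fix a assume "a \<in> {0..<int p} \<times> {0..<int p}"
  then have "a = rep2 p a"
    by (auto simp: rep2_def)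
  then show "a \<in> range (rep2 p)"
    by blast
qed (use assms in \<open>auto simp: rep2_def\<close>)

lemma character_group_plane:
  assumes p: "p > 0"
  shows "character_group (rep2 p) p ({0..<int p} \<times> {0..<int p}) (0, 0) lin"
proof
  fix a :: "int \<times> int"
  have "(\<Sum>\<chi>\<in>{0..<int p} \<times> {0..<int p}. ec p (lin \<chi> a))
    = (\<Sum>u\<in>{0..<int p}. ec p (u * fst a)) * (\<Sum>v\<in>{0..<int p}. ec p (v * snd a))"
    by (simp add: sum_product sum.cartesian_product lin_def ec_add case_prod_beta)
  also have "\<dots> = (if rep2 p a = rep2 p 0 then of_nat (card (range (rep2 p))) else 0)"
  proof -
    have "rep2 p a = rep2 p 0 \<longleftrightarrow> int p dvd fst a \<and> int p dvd snd a"
      by (simp add: rep2_def dvd_eq_mod_eq_0)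
    then show ?thesis
      unfolding sum_ec_orthogonal[OF p] by (simp add: range_rep2 p card_cartesian_product)
  qed
  finally show "(\<Sum>\<chi>\<in>{0..<int p} \<times> {0..<int p}. ec p (lin \<chi> a))
    = (if rep2 p a = rep2 p 0 then of_nat (card (range (rep2 p))) else 0)" .
  show "finite (range (rep2 p))"
    by (simp add: range_rep2 p)
qed (use p in \<open>auto simp: rep2_def lin_def mod_simps algebra_simps\<close>)

text \<open>The combinations m d + n e with 0 \<le> m, n < q are q^2 distinct group elements,
  because the determinant is invertible modulo p and q \<le> p. With q^2 \<ge> 2 |Y|, averaging
  finds one of gain at least |Y| / 2, while each has gain at most 2 q times the larger of the gains
  at d and e. As q is of order sqrt |Y|, so is that larger gain.\<close>

lemma gain_large_plane:
  assumes p: "prime p" and Y: "Y \<subseteq> range (rep2 p)" "Y \<noteq> {}" "2 * card Y \<le> p * p"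
    and det: "\<not> int p dvd fst d * snd e - fst e * snd d"
  shows "\<exists>x\<in>{d, e}. sqrt (real (card Y)) \<le> 10 * real (quotient_group.gain (rep2 p) Y x)"
proof -
  have p0: "p > 0"
    using p by (rule prime_gt_0_nat)
  interpret character_group "rep2 p" p "{0..<int p} \<times> {0..<int p}" "(0, 0)" lin
    by (rule character_group_plane[OF p0])
  define y where "y = real (card Y)"
  have "card Y > 0"
    using Y finite_subset_range by (simp add: card_gt_0_iff)
  then have y: "y \<ge> 1"
    by (simp add: y_def)
  \<comment> \<open>The least q with q^2 \<ge> 2 |Y|; the hypothesis 2 |Y| \<le> p^2 is what gives q
    \<le> p.\<close>
  define q where "q = nat \<lceil>sqrt (2 * y)\<rceil>"
  have q1: "sqrt (2 * y) \<le> real q"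
    unfolding q_def by (rule real_nat_ceiling_ge)
  have q2: "real q < sqrt (2 * y) + 1"
    unfolding q_def using y real_sqrt_ge_zero[of "2 * y"] by linarith
  have "2 * y \<le> (real p)\<^sup>2"
    using Y(3) unfolding y_def power2_eq_square by (metis of_nat_le_iff of_nat_mult of_nat_numeral)
  then have "sqrt (2 * y) \<le> real p"
    by (intro real_le_lsqrt) (use y in auto)
  then have qp: "q \<le> p"
    unfolding q_def by (simp add: ceiling_le_iff nat_le_iff)
  have qq: "2 * y \<le> (real q)\<^sup>2"
    using q1 y by (metis real_sqrt_le_iff real_sqrt_abs abs_of_nat)
  define c where "c = max (gain Y d) (gain Y e)"
  define f where "f = (\<lambda>(m::nat, n::nat). rep2 p ((\<Sum>i<m. d) + (\<Sum>i<n. e)))"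
  define E where "E = f ` ({..<q} \<times> {..<q})"
  have inj: "inj_on f ({..<q} \<times> {..<q})"
  proof (rule inj_onI, clarify)
    fix m n m' n' assume lt: "m < q" "n < q" "m' < q" "n' < q" and eq: "f (m, n) = f (m', n')"
    define x where "x = int m - int m'"
    define z where "z = int n - int n'"
    have "int p dvd (int m * fst d + int n * fst e) - (int m' * fst d + int n' * fst e)"
      "int p dvd (int m * snd d + int n * snd e) - (int m' * snd d + int n' * snd e)"
      using eq unfolding f_def rep2_def by (simp_all add: fst_sum snd_sum mod_eq_dvd_iff)
    then have 1: "int p dvd x * fst d + z * fst e" and 2: "int p dvd x * snd d + z * snd e"
      unfolding x_def z_def by (simp_all add: algebra_simps)
    have "int p dvd (x * fst d + z * fst e) * snd e - (x * snd d + z * snd e) * fst e"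
      by (intro dvd_diff dvd_mult2 1 2)
    then have "int p dvd x * (fst d * snd e - fst e * snd d)"
      by (simp add: algebra_simps)
    then have x: "int p dvd x"
      using det p by (meson prime_dvd_mult_iff prime_nat_int_transfer)
    have "int p dvd (x * snd d + z * snd e) * fst d - (x * fst d + z * fst e) * snd d"
      by (intro dvd_diff dvd_mult2 1 2)
    then have "int p dvd z * (fst d * snd e - fst e * snd d)"
      by (simp add: algebra_simps)
    then have z: "int p dvd z"
      using det p by (meson prime_dvd_mult_iff prime_nat_int_transfer)
    have "x = 0"
      using x lt qp dvd_imp_le_int[of x "int p"] unfolding x_def by fastforce
    moreover have "z = 0"
      using z lt qp dvd_imp_le_int[of z "int p"] unfolding z_def by fastforce
    ultimately show "m = m' \<and> n = n'"
      by (simp add: x_def z_def)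
  qed
  have "card E = card ({..<q} \<times> {..<q})"
    unfolding E_def by (rule card_image[OF inj])
  then have cardE: "card E = q * q"
    by (simp add: card_cartesian_product)
  have "gain Y x \<le> 2 * q * c" if x: "x \<in> E" for x
  proof -
    obtain m n where mn: "m < q" "n < q" "x = rep2 p ((\<Sum>i<m. d) + (\<Sum>i<n. e))"
      using x unfolding E_def f_def by auto
    have "gain Y x = gain Y ((\<Sum>i<m. d) + (\<Sum>i<n. e))"
      unfolding mn(3) gain_def shift_rep ..
    also have "\<dots> \<le> gain Y (\<Sum>i<m. d) + gain Y (\<Sum>i<n. e)"
      by (rule gain_add[OF Y(1)])
    also have "\<dots> \<le> m * gain Y d + n * gain Y e"
      by (intro add_mono gain_multiple Y(1))
    also have "\<dots> \<le> q * c + q * c"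
      using mn by (intro add_mono mult_mono) (auto simp: c_def)
    finally show ?thesis by simp
  qed
  moreover have "E \<subseteq> range (rep2 p)"
    unfolding E_def f_def by auto
  ultimately have "card E * card Y \<le> card Y * card Y + card E * (2 * q * c)"
    by (intro gain_average Y(1))
  then have "real (card E * card Y) \<le> real (card Y * card Y + card E * (2 * q * c))"
    by (simp only: of_nat_le_iff)
  then have avg: "(real q)\<^sup>2 * y \<le> y * y + (real q)\<^sup>2 * (2 * real q * real c)"
    unfolding cardE y_def by (simp add: power2_eq_square)
  have "y * (2 * y) \<le> y * (real q)\<^sup>2"
    using qq y by (intro mult_left_mono) auto
  then have "(real q)\<^sup>2 * y \<le> (real q)\<^sup>2 * (4 * real q * real c)"
    using avg by (simp add: algebra_simps)
  moreover have "(real q)\<^sup>2 > 0"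
    using qq y by linarith
  ultimately have yc: "y \<le> 4 * real q * real c"
    by simp
  have s: "1 \<le> sqrt y" "sqrt y * sqrt y = y"
    using y by auto
  \<comment> \<open>Origin of 10: as sqrt y \<ge> 1, q < sqrt 2 * sqrt y + 1 \<le> 5/2 * sqrt y,
    which turns 4 q c into 10 c * sqrt y.\<close>
  have "sqrt 2 \<le> 3 / 2"
    by (rule real_le_lsqrt) (auto simp: power2_eq_square)
  then have "sqrt 2 * sqrt y \<le> 3 / 2 * sqrt y"
    using s by (intro mult_right_mono) auto
  then have "real q \<le> 5 / 2 * sqrt y"
    using q2 s(1) unfolding real_sqrt_mult by linarith
  then have "4 * real q * real c \<le> 4 * (5 / 2 * sqrt y) * real c"
    by (intro mult_right_mono mult_left_mono) auto
  then have "sqrt y * sqrt y \<le> sqrt y * (10 * real c)"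
    using yc s(2) by (simp add: algebra_simps)
  then have "sqrt y \<le> 10 * real c"
    by (rule mult_left_le_imp_le) (use s(1) in linarith)
  then show ?thesis
    unfolding c_def y_def by (auto simp: max_def split: if_splits)
qed

text \<open>The remaining elements never lie on one line, so a base point and two others give
  independent differences, one of which has gain at least sqrt |Y| / 10. This sustains a schedule
  quadratic in s: the increment of (s / 40)^2 is (2 s + 1) / 1600, which such a gain exceeds when
  |Y| \<ge> (s / 40)^2.\<close>

lemma plane_cover:
  fixes \<epsilon> :: real
  assumes \<epsilon>: "\<epsilon> > 0"
  shows "\<exists>\<eta>>0. \<exists>p0. \<forall>p\<ge>p0. prime p \<longrightarrow> (\<forall>A :: (int \<times> int) multiset.
    \<epsilon> * real p \<le> size A \<and>
    (\<forall>u w. rep2 p u \<noteq> (0, 0) \<longrightarrow> real (size {#a \<in># A. lin u a mod int p = w#}) \<le> \<eta> * real p) \<longrightarrow>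
    (\<exists>k R. R \<subseteq># A \<and> size R = 2 * k \<and> real (size R) \<le> \<epsilon> * real p \<and>
      (\<forall>t. \<exists>B. B \<subseteq># R \<and> size B = k \<and> rep2 p (sum_mset B) = rep2 p t)))"
proof -
  \<comment> \<open>6553600 = (64 * 40)^2: the elementary phase has S \<ge> \<epsilon> p / 64 steps
    and ends with at least (S / 40)^2 \<ge> \<theta> p^2 sums.\<close>
  define \<theta> where "\<theta> = \<epsilon>\<^sup>2 / 6553600"
  have \<theta>: "\<theta> > 0"
    using \<epsilon> by (simp add: \<theta>_def)
  define M where "M = Suc (nat \<lceil>320 / (\<theta> * \<epsilon>)\<rceil>)"
  have M: "320 / (\<theta> * \<epsilon>) \<le> real M" "M > 0"
    unfolding M_def using real_nat_ceiling_ge[of "320 / (\<theta> * \<epsilon>)"] by linarith+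
  define \<eta> where "\<eta> = \<epsilon> / (16 * real M)"
  have \<eta>: "\<eta> > 0"
    using M \<epsilon> by (simp add: \<eta>_def)
  define p0 where "p0 = max M (nat \<lceil>64 / \<epsilon>\<rceil>)"
  have "\<exists>k R. R \<subseteq># A \<and> size R = 2 * k \<and> real (size R) \<le> \<epsilon> * real p \<and>
      (\<forall>t. \<exists>B. B \<subseteq># R \<and> size B = k \<and> rep2 p (sum_mset B) = rep2 p t)"
    if pp: "p \<ge> p0" "prime p" and A: "\<epsilon> * real p \<le> size A"
      and fib: "\<forall>u w. rep2 p u \<noteq> (0, 0) \<longrightarrow> real (size {#a \<in># A. lin u a mod int p = w#}) \<le> \<eta> * real p"
    for p and A :: "(int \<times> int) multiset"
  proof -
    have p: "p > 0"
      using pp(2) by (rule prime_gt_0_nat)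
    interpret character_group "rep2 p" p "{0..<int p} \<times> {0..<int p}" "(0, 0)" lin
      by (rule character_group_plane[OF p])
    have card_range: "card (range (rep2 p)) = p * p"
      by (simp add: range_rep2 p card_cartesian_product)
    have "M \<le> p" "nat \<lceil>64 / \<epsilon>\<rceil> \<le> p"
      using pp by (auto simp: p0_def)
    then have "64 / \<epsilon> \<le> real p"
      by linarith
    then have rp: "64 \<le> \<epsilon> * real p"
      using \<epsilon> by (simp add: field_simps)
    define S where "S = nat \<lfloor>\<epsilon> * real p / 32\<rfloor>"
    have S: "real S \<le> \<epsilon> * real p / 32" "\<epsilon> * real p / 64 \<le> real S"
      unfolding S_def using rp by linarith+
    have Mk: "8 * real M * (\<eta> * real p) = \<epsilon> * real p / 2"
      using M by (simp add: \<eta>_def)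
    have ep: "0 < \<epsilon> * real p" "0 < \<eta> * real p"
      using \<epsilon> \<eta> p by auto
    have "1 * (\<eta> * real p) \<le> 8 * real M * (\<eta> * real p)"
      using M(2) ep by (intro mult_right_mono) linarith+
    moreover have "1 * (\<eta> * real p) \<noteq> 8 * real M * (\<eta> * real p)"
      using M(2) ep p by auto
    ultimately have dsmall: "\<eta> * real p < \<epsilon> * real p / 2"
      using Mk by linarith
    have "\<exists>k Q. Q \<subseteq># A \<and> size Q = 2 * k \<and> real (size Q) \<le> \<epsilon> * real p \<and> reach k Q = range (rep2 p)"
    proof (rule reach_cover[where h = "\<lambda>s. (real s / 40)\<^sup>2" and \<kappa> = "\<eta> * real p" and M = M and \<theta> = \<theta> and S = S])
      fix \<chi> :: "int \<times> int" and w :: int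
      assume chi: "\<chi> \<in> {0..<int p} \<times> {0..<int p} - {(0, 0)}"
      then have "rep2 p \<chi> = \<chi>"
        by (auto simp: rep2_def)
      then show "real (size {#a \<in># A. lin \<chi> a mod int p = w#}) \<le> \<eta> * real p"
        using fib[rule_format, of \<chi> w] chi by simp
    next
      show "8 * real M * (\<eta> * real p) + \<epsilon> * real p / 2 \<le> real (size A)"
        using Mk A by linarith
      show "\<epsilon> * real p / 2 < real (size A)"
        using A ep by linarith
      have "(\<epsilon> * real p / 2560)\<^sup>2 \<le> (real S / 40)\<^sup>2"
        using S(2) ep by (intro power_mono) auto
      then show "\<theta> * real (card (range (rep2 p))) \<le> (real S / 40)\<^sup>2"
        unfolding card_range \<theta>_def by (simp add: power2_eq_square)
    next
      fix s D and Y :: "(int \<times> int) set"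
      assume D: "D \<subseteq># A" "real (size A) \<le> real (size D) + \<epsilon> * real p / 2"
        and Y: "Y \<subseteq> range (rep2 p)" "Y \<noteq> {}" "(real s / 40)\<^sup>2 \<le> real (card Y)"
          "2 * card Y \<le> card (range (rep2 p))"
      have "real (size D) \<ge> \<epsilon> * real p / 2"
        using D(2) A by linarith
      then have Dbig: "real (size D) > \<eta> * real p"
        using dsmall by linarith
      then have "size D > 0"
        using ep by (metis gr0I less_asym of_nat_0)
      then obtain a where a: "a \<in># D"
        by (metis multiset_nonemptyE nonempty_has_size)
      have off: "\<exists>b\<in>#D. \<not> int p dvd lin u (b - a)" if u: "rep2 p u \<noteq> (0, 0)" for u
      proof (rule ccontr)
        assume "\<not> ?thesis"
        then have "\<forall>b\<in>#D. lin u b mod int p = lin u a mod int p"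
          by (auto simp: mod_eq_dvd_iff lin_def algebra_simps)
        then have "{#c \<in># D. lin u c mod int p = lin u a mod int p#} = D"
          by (simp add: filter_mset_eq_conv)
        then have "size D \<le> size {#c \<in># A. lin u c mod int p = lin u a mod int p#}"
          using size_filter_mset_mono[OF D(1), of "\<lambda>c. lin u c mod int p = lin u a mod int p"] by simp
        then show False
          using fib u Dbig by (meson le_less_trans less_irrefl of_nat_le_iff order_trans)
      qed
      have "1 < p"
        using pp(2) by (rule prime_gt_1_nat)
      then have "rep2 p (1, 0) \<noteq> (0, 0)"
        by (simp add: rep2_def)
      then obtain b where b: "b \<in># D" "\<not> int p dvd lin (1, 0) (b - a)"
        using off by blast
      \<comment> \<open>A form vanishing on b - a; its value at c - a is the determinant of the two
        differences.\<close>
      define u where "u = (- snd (b - a), fst (b - a))"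
      have "rep2 p u \<noteq> (0, 0)"
        using b(2) by (auto simp: rep2_def u_def lin_def dvd_eq_mod_eq_0)
      then obtain c where c: "c \<in># D" "\<not> int p dvd lin u (c - a)"
        using off by blast
      have "\<not> int p dvd fst (b - a) * snd (c - a) - fst (c - a) * snd (b - a)"
        using c(2) by (simp add: lin_def u_def algebra_simps)
      then obtain x where x: "x \<in> {b - a, c - a}" "sqrt (real (card Y)) \<le> 10 * real (gain Y x)"
        using gain_large_plane[OF pp(2) Y(1,2)] Y(4) card_range by metis
      then obtain b' where b': "b' \<in># D" "sqrt (real (card Y)) \<le> 10 * real (gain Y (b' - a))"
        using b c by blast
      have "card Y > 0"
        using Y finite_subset_range by (simp add: card_gt_0_iff)
      then have y: "1 \<le> sqrt (real (card Y))"
        by simp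
      have "real s / 40 \<le> sqrt (real (card Y))"
        using Y(3) by (rule real_le_rsqrt)
      then have "2 * real s + 1 \<le> 160 * sqrt (real (card Y))"
        using y by linarith
      then have "2 * real s + 1 \<le> 1600 * real (gain Y (b' - a))"
        using b'(2) by linarith
      then have "(real (Suc s) / 40)\<^sup>2 \<le> (real s / 40)\<^sup>2 + real (gain Y (b' - a))"
        by (simp add: power2_eq_square field_simps)
      moreover have "0 < gain Y (b' - a)"
        using b'(2) y by (cases "gain Y (b' - a)") auto
      ultimately show "\<exists>a\<in>#D. \<exists>b\<in>#D. 0 < gain Y (a - b) \<and> (real (Suc s) / 40)\<^sup>2 \<le> real (card Y + gain Y (a - b))"
        using a b'(1) Y(3) by (intro bexI[of _ b'] bexI[of _ a]) auto
    qed (use \<epsilon> rp S \<theta> M \<open>M \<le> p\<close> in auto)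
    then obtain k Q where Q: "Q \<subseteq># A" "size Q = 2 * k" "real (size Q) \<le> \<epsilon> * real p"
      and reach: "reach k Q = range (rep2 p)"
      by blast
    have "\<exists>B. B \<subseteq># Q \<and> size B = k \<and> rep2 p (sum_mset B) = rep2 p t" for t
    proof -
      have "rep2 p t \<in> reach k Q"
        unfolding reach by blast
      then show ?thesis
        unfolding reach_def by fastforce
    qed
    then show ?thesis
      using Q by blast
  qed
  then show ?thesis
    using \<eta> by blast
qed

section \<open>Zero-sum sub-multisets in cyclic groups\<close>

lemma exists_submset_of_size:
  assumes "n \<le> size A"
  shows "\<exists>B. B \<subseteq># A \<and> size B = n"
proof -
  obtain xs where xs: "mset xs = A"
    using ex_mset by blast
  have "mset (take n xs) \<subseteq># A"
    using xs by (metis append_take_drop_id mset_append mset_subset_eq_add_left)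
  moreover have "size (mset (take n xs)) = n"
    using assms xs by auto
  ultimately show ?thesis by blast
qed

lemma submset_image_mset_lift:
  assumes "B \<subseteq># image_mset f R"
  shows "\<exists>B'. B' \<subseteq># R \<and> image_mset f B' = B"
proof -
  obtain D where "image_mset f R = B + D"
    using assms by (metis subset_mset.add_diff_inverse)
  then show ?thesis
    by (metis image_mset_eq_plusD mset_subset_eq_add_left)
qed

lemma add_submset_diff: "R \<subseteq># A \<Longrightarrow> Q \<subseteq># A - R \<Longrightarrow> R + Q \<subseteq># A"
  by (metis subset_mset.le_diff_conv2 union_commute)

text \<open>The Cauchy-Davenport bound for sums of two-element sets: each pair with distinct
  residues adds at least one sum as long as the group is not exhausted.\<close>

lemma card_reach_pairs:
  fixes as bs :: "int list"
  assumes p: "prime p" and len: "length as = length bs" "length as < p"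
    and ne: "\<And>i. i < length as \<Longrightarrow> \<not> int p dvd as ! i - bs ! i"
  shows "length as < card (quotient_group.reach (\<lambda>x. x mod int p) (length as) (mset as + mset bs))"
proof -
  have p0: "p > 0"
    using p by (rule prime_gt_0_nat)
  interpret character_group "\<lambda>x. x mod int p" p "{0..<int p}" 0 "\<lambda>u a. u * a"
    by (rule character_group_int[OF p0])
  show ?thesis
    using len ne
  proof (induction as bs rule: list_induct2)
    case Nil
    then show ?case
      by (simp add: reach_zero)
  next
    case (Cons a as b bs)
    let ?Y = "reach (length as) (mset as + mset bs)"
    have "length as < card ?Y"
    proof (rule Cons.IH)
      show "length as < p"
        using Cons.prems by simp
      show "\<not> int p dvd as ! i - bs ! i" if "i < length as" for i
        using Cons.prems(2)[of "Suc i"] that by simp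
    qed
    moreover have "Suc (length as) < card ?Y + gain ?Y (a - b)"
    proof (cases "card ?Y < p")
      case True
      have "0 < gain ?Y (a - b)"
      proof (rule gain_pos_int[OF p])
        show "?Y \<subseteq> {0..<int p}"
          using reach_subset[of "length as" "mset as + mset bs"] p0 by (simp add: range_mod_int)
        show "?Y \<noteq> {}"
          using \<open>length as < card ?Y\<close> by auto
        show "\<not> int p dvd a - b"
          using Cons.prems(2)[of 0] by simp
      qed (rule True)
      then show ?thesis
        using \<open>length as < card ?Y\<close> by linarith
    next
      case False
      then show ?thesis
        using Cons.prems(1) by simp
    qed
    moreover have "mset (a # as) + mset (b # bs) = mset as + mset bs + {#a, b#}"
      by simp
    ultimately show ?case
      using card_reach_add_pair[of "length as" "mset as + mset bs" a b] by (simp only: length_Cons)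
  qed
qed

text \<open>Sort by residue and compare positions i and i + p - 1. If they agree for some i, the p
  elements between them all have one residue, and their sum vanishes. Otherwise the p - 1 pairs have
  distinct members, so choosing one from each realises every residue, in particular the negative of
  the element at position 2p - 2, which is the last of the first 2p - 1.\<close>

lemma erdos_ginzburg_ziv:
  fixes f :: "'a \<Rightarrow> int"
  assumes p: "prime p" and C: "2 * p - 1 \<le> size C"
  shows "\<exists>B. B \<subseteq># C \<and> size B = p \<and> int p dvd (\<Sum>b\<in>#B. f b)"
proof -
  have p0: "p > 0"
    using p by (rule prime_gt_0_nat)
  define key where "key a = f a mod int p" for a
  obtain zs where zs: "mset zs = C"
    using ex_mset by blast
  define xs where "xs = sort_key key zs"
  have xs: "mset xs = C" "sorted (map key xs)" "length xs = size C"
    using zs by (auto simp: xs_def)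
  have part: "mset (take m (drop i xs)) \<subseteq># C" for i m
  proof -
    have "mset xs = mset (take i xs) + mset (take m (drop i xs)) + mset (drop m (drop i xs))"
      by (metis append_take_drop_id mset_append union_assoc)
    then show ?thesis
      using xs(1) by (metis mset_subset_eq_add_left mset_subset_eq_add_right subset_mset.order_trans)
  qed
  show ?thesis
  proof (cases "\<exists>i<p - 1. key (xs ! i) = key (xs ! (i + (p - 1)))")
    case True
    then obtain i where i: "i < p - 1" "key (xs ! i) = key (xs ! (i + (p - 1)))"
      by blast
    define B where "B = mset (take p (drop i xs))"
    have len: "length (take p (drop i xs)) = p"
      using i C xs(3) by simp
    have eq: "key b = key (xs ! i)" if "b \<in># B" for b
    proof -
      obtain j where j: "j < p" "b = xs ! (i + j)"
        using \<open>b \<in># B\<close> len unfolding B_def by (auto simp: in_set_conv_nth)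
      have "map key xs ! i \<le> map key xs ! (i + j)" "map key xs ! (i + j) \<le> map key xs ! (i + (p - 1))"
        using i j C xs(3) by (intro sorted_nth_mono[OF xs(2)]; simp)+
      then show ?thesis
        using i j C xs(3) by simp
    qed
    have "(\<Sum>b\<in>#B. f b) mod int p = (\<Sum>b\<in>#B. key b) mod int p"
      by (induction B) (auto simp: key_def mod_simps, metis mod_add_cong)
    also have "(\<Sum>b\<in>#B. key b) = (\<Sum>b\<in>#B. key (xs ! i))"
      using eq by (metis image_mset_cong)
    also have "\<dots> = int (size B) * key (xs ! i)"
      by simp
    also have "size B = p"
      unfolding B_def using len by simp
    finally have "int p dvd (\<Sum>b\<in>#B. f b)"
      by (simp add: dvd_eq_mod_eq_0)
    then show ?thesis
      using part[of p i] len unfolding B_def by (intro exI[of _ "mset (take p (drop i xs))"]) auto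
  next
    case False
    interpret character_group "\<lambda>x. x mod int p" p "{0..<int p}" 0 "\<lambda>u a. u * a"
      by (rule character_group_int[OF p0])
    define as where "as = take (p - 1) xs"
    define bs where "bs = take (p - 1) (drop (p - 1) xs)"
    define c where "c = xs ! (2 * p - 2)"
    have len: "length as = p - 1" "length bs = p - 1"
      using C xs(3) by (auto simp: as_def bs_def)
    have "take (2 * p - 1) xs = as @ bs @ [c]"
    proof -
      have "2 * p - 1 = Suc (2 * p - 2)" "2 * p - 2 < length xs"
        using C xs(3) p0 by auto
      then have "take (2 * p - 1) xs = take (2 * p - 2) xs @ [c]"
        by (simp add: take_Suc_conv_app_nth c_def)
      moreover have "2 * p - 2 = (p - 1) + (p - 1)"
        by simp
      then have "take (2 * p - 2) xs = as @ bs"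
        by (simp only: take_add as_def bs_def)
      ultimately show ?thesis by simp
    qed
    then have sub: "mset as + mset bs + {#c#} \<subseteq># C"
      using part[of "2 * p - 1" 0] by (simp add: union_assoc)
    have "\<not> int p dvd map f as ! i - map f bs ! i" if "i < p - 1" for i
    proof -
      have "key (as ! i) \<noteq> key (bs ! i)"
        using False that C xs(3) by (auto simp: as_def bs_def add.commute)
      then show ?thesis
        using that len by (simp add: key_def mod_eq_dvd_iff)
    qed
    then have "p - 1 < card (reach (p - 1) (mset (map f as) + mset (map f bs)))"
      using card_reach_pairs[OF p, of "map f as" "map f bs"] len p0 by simp
    moreover have sub_range: "reach (p - 1) (mset (map f as) + mset (map f bs)) \<subseteq> {0..<int p}"
      using reach_subset p0 by (metis range_mod_int)
    ultimately have "reach (p - 1) (mset (map f as) + mset (map f bs)) = {0..<int p}"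
      by (intro card_subset_eq) (use card_mono[OF _ sub_range] in auto)
    then have "(- f c) mod int p \<in> reach (p - 1) (image_mset f (mset as + mset bs))"
      using p0 by simp
    then obtain D where D: "D \<subseteq># image_mset f (mset as + mset bs)" "size D = p - 1"
        "sum_mset D mod int p = (- f c) mod int p"
      unfolding reach_def by fastforce
    then obtain B where B: "B \<subseteq># mset as + mset bs" "image_mset f B = D"
      using submset_image_mset_lift by blast
    have "B + {#c#} \<subseteq># C"
      using B(1) sub by (meson subset_mset.order_trans subset_mset.add_right_mono)
    moreover have "size (B + {#c#}) = p"
      using B(2) D(2) p0 by (metis Suc_pred' add.commute plus_1_eq_Suc size_image_mset size_single size_union)
    moreover have "int p dvd (\<Sum>b\<in>#B + {#c#}. f b)"
      using D(3) B(2) by (simp add: mod_eq_dvd_iff add.commute)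
    ultimately show ?thesis
      by blast
  qed
qed

text \<open>Among the p + 1 prefix sums of lengths 0 to p two agree modulo p; the block between them
  has sum 0.\<close>

lemma exists_short_zero_sum:
  fixes f :: "'a \<Rightarrow> int"
  assumes p: "p > 0" and C: "p \<le> size C"
  shows "\<exists>B. B \<subseteq># C \<and> B \<noteq> {#} \<and> size B \<le> p \<and> int p dvd (\<Sum>b\<in>#B. f b)"
proof -
  obtain xs where xs: "mset xs = C"
    using ex_mset by blast
  then have len: "p \<le> length xs"
    using C by auto
  define s where "s i = sum_list (map f (take i xs)) mod int p" for i
  have "s ` {..p} \<subseteq> {0..<int p}"
    using p by (auto simp: s_def)
  then have "card (s ` {..p}) < card {..p}"
    using card_mono[of "{0..<int p}" "s ` {..p}"] by simp
  then have "\<not> inj_on s {..p}"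
    using pigeonhole by blast
  then obtain i j where ij: "i < j" "j \<le> p" "s i = s j"
    unfolding inj_on_def by (metis atMost_iff linorder_neqE_nat)
  define ys where "ys = drop i (take j xs)"
  have eq: "take j xs = take i xs @ ys"
    unfolding ys_def using ij by (metis append_take_drop_id min.absorb1 less_imp_le take_take)
  have "mset ys \<subseteq># C"
    using eq xs by (metis append_take_drop_id mset_append mset_subset_eq_add_left mset_subset_eq_add_right
        subset_mset.order_trans)
  moreover have "length ys = j - i"
    unfolding ys_def using ij len by simp
  moreover have "int p dvd sum_list (map f ys)"
  proof -
    have "s j = (sum_list (map f (take i xs)) + sum_list (map f ys)) mod int p"
      unfolding s_def eq by simp
    then have "int p dvd (sum_list (map f (take i xs)) + sum_list (map f ys)) - sum_list (map f (take i xs))"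
      using ij(3) unfolding s_def by (metis mod_eq_dvd_iff)
    then show ?thesis by simp
  qed
  then have "int p dvd (\<Sum>b\<in>#mset ys. f b)"
    by (metis mset_map sum_mset_sum_list)
  ultimately show ?thesis
    using ij by (intro exI[of _ "mset ys"]) auto
qed

text \<open>Exchanging elements later needs a zero sum that is not too short. Take a longest one B
  of size at most p. If it had at most m elements, the remainder would contain another zero sum D,
  no longer than B by maximality, and B + D would be longer and still of size at most 2m \<le>
  p.\<close>

lemma exists_medium_zero_sum:
  fixes f :: "'a \<Rightarrow> int"
  assumes p: "p > 0" and m: "2 * m \<le> p" and C: "p + m \<le> size C"
  shows "\<exists>B. B \<subseteq># C \<and> m < size B \<and> size B \<le> p \<and> int p dvd (\<Sum>b\<in>#B. f b)"
proof -
  let ?P = "\<lambda>B. B \<subseteq># C \<and> size B \<le> p \<and> int p dvd (\<Sum>b\<in>#B. f b)"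
  have "\<exists>B. ?P B \<and> (\<forall>D. ?P D \<longrightarrow> size D \<le> size B)"
    by (rule ex_has_greatest_nat[of ?P "{#}" size "Suc p"]) auto
  then obtain B where B: "?P B" and max: "\<And>D. ?P D \<Longrightarrow> size D \<le> size B"
    by blast
  have "m < size B"
  proof (rule ccontr)
    assume small: "\<not> m < size B"
    then have "p \<le> size (C - B)"
      using B C by (simp add: size_Diff_submset)
    then obtain D where D: "D \<subseteq># C - B" "D \<noteq> {#}" "size D \<le> p" "int p dvd (\<Sum>b\<in>#D. f b)"
      using exists_short_zero_sum[OF p] by blast
    have "?P D"
      using D by (meson diff_subset_eq_self subset_mset.order_trans)
    then have "size D \<le> size B"
      by (rule max)
    then have "?P (B + D)"
      using B D small m add_submset_diff[of B C D] by (auto intro: dvd_add)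
    then have "size (B + D) \<le> size B"
      by (rule max)
    then show False
      using D(2) by simp
  qed
  then show ?thesis
    using B by blast
qed

section \<open>Lines in the plane\<close>

lemma sum_mset_lin: "(\<Sum>b\<in>#B. lin u b) = lin u (sum_mset B)"
  by (induction B) (simp_all add: lin_add, simp add: lin_def)

lemma lin_diff: "lin u (a - b) = lin u a - lin u b"
  by (simp add: lin_def algebra_simps)

definition det2 :: "int \<times> int \<Rightarrow> int \<times> int \<Rightarrow> int" where
  "det2 u v = fst u * snd v - snd u * fst v"

lemma rep2_eq_iff: "rep2 p a = rep2 p b \<longleftrightarrow> int p dvd fst (a - b) \<and> int p dvd snd (a - b)"
  by (simp add: rep2_def mod_eq_dvd_iff)

text \<open>Cramer's rule: two independent forms determine a point modulo p.\<close>

lemma rep2_eqI: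
  assumes p: "prime p" and det: "\<not> int p dvd det2 u v"
    and u: "int p dvd lin u (a - b)" and v: "int p dvd lin v (a - b)"
  shows "rep2 p a = rep2 p b"
proof -
  have prime: "prime (int p)"
    using p by simp
  have "int p dvd lin u (a - b) * snd v - lin v (a - b) * snd u"
    "int p dvd lin v (a - b) * fst u - lin u (a - b) * fst v"
    using u v by (simp_all add: dvd_diff)
  moreover have "lin u (a - b) * snd v - lin v (a - b) * snd u = det2 u v * fst (a - b)"
    "lin v (a - b) * fst u - lin u (a - b) * fst v = det2 u v * snd (a - b)"
    by (simp_all add: lin_def det2_def algebra_simps)
  ultimately show ?thesis
    unfolding rep2_eq_iff using det by (metis prime prime_dvd_mult_iff)
qed

lemma zero_sum_iff_rep2: "zero_sum p B \<longleftrightarrow> rep2 p (sum_mset B) = rep2 p 0"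
proof -
  have "(\<Sum>x\<in>#B. fst x) = fst (sum_mset B)" "(\<Sum>x\<in>#B. snd x) = snd (sum_mset B)"
    by (induction B) auto
  then show ?thesis
    unfolding zero_sum_def rep2_def cong_def by simp
qed

lemma parallel_dvd:
  assumes p: "prime p" and par: "int p dvd det2 u v" and v: "rep2 p v \<noteq> (0, 0)"
    and x: "int p dvd lin v x"
  shows "int p dvd lin u x"
proof -
  have prime: "prime (int p)"
    using p by simp
  have "fst v * lin u x = fst u * lin v x - det2 u v * snd x"
    "snd v * lin u x = snd u * lin v x + det2 u v * fst x"
    by (simp_all add: lin_def det2_def algebra_simps)
  then have "int p dvd fst v * lin u x" "int p dvd snd v * lin u x"
    using par x by (simp_all add: dvd_diff dvd_add)
  moreover have "\<not> int p dvd fst v \<or> \<not> int p dvd snd v"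
    using v by (auto simp: rep2_def dvd_eq_mod_eq_0)
  ultimately show ?thesis
    using prime by (meson prime_dvd_mult_iff)
qed

lemma exists_transversal:
  assumes "rep2 p u \<noteq> (0, 0)"
  shows "\<exists>v. \<not> int p dvd det2 u v"
proof (cases "int p dvd fst u")
  case True
  then have "\<not> int p dvd snd u"
    using assms by (simp add: rep2_def dvd_eq_mod_eq_0)
  then have "\<not> int p dvd det2 u (1, 0)"
    by (simp add: det2_def)
  then show ?thesis ..
next
  case False
  then have "\<not> int p dvd det2 u (0, 1)"
    by (simp add: det2_def)
  then show ?thesis ..
qed

definition line :: "nat \<Rightarrow> int \<times> int \<Rightarrow> int \<Rightarrow> (int \<times> int) multiset \<Rightarrow> (int \<times> int) multiset" where
  "line p u w A = {#a \<in># A. lin u a mod int p = w#}"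

lemma line_subset: "line p u w A \<subseteq># A"
  by (simp add: line_def)

text \<open>On a line the transversal form \<open>v\<close> separates points, so its fibres there
  are single points, whose multiplicities are small. Only \<open>lin v\<close> of the sum needs to
  be prescribed: \<open>lin u\<close> is fixed by the length.\<close>

lemma line_cover:
  fixes \<eta> \<rho> :: real
  assumes "\<eta> > 0" "\<rho> > 0"
  shows "\<exists>\<delta>>0. \<exists>p0. \<forall>p\<ge>p0. prime p \<longrightarrow> (\<forall>A u v w.
    set_mset A \<subseteq> Zp2 p \<and> (\<forall>x. real (count A x) \<le> \<delta> * real p) \<and> \<not> int p dvd det2 u v \<and>
    \<eta> * real p \<le> size (line p u w A) \<longrightarrow>
    (\<exists>k R. R \<subseteq># line p u w A \<and> size R = 2 * k \<and> real (size R) \<le> \<rho> * real p \<and>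
      (\<forall>t. \<exists>B. B \<subseteq># R \<and> size B = k \<and> [lin v (sum_mset B) = t] (mod int p))))"
proof -
  obtain \<delta> p0 where \<delta>: "\<delta> > 0" and cover: "\<And>p (C :: int multiset). p \<ge> p0 \<Longrightarrow> prime p \<Longrightarrow> \<eta> * real p \<le> size C \<Longrightarrow>
      (\<forall>w. real (size {#c \<in># C. c mod int p = w#}) \<le> \<delta> * real p) \<Longrightarrow>
      (\<exists>k R. R \<subseteq># C \<and> size R = 2 * k \<and> real (size R) \<le> \<rho> * real p \<and>
        (\<forall>t. \<exists>B. B \<subseteq># R \<and> size B = k \<and> [sum_mset B = t] (mod int p)))"
    using cyclic_cover[OF assms] by metis
  have "\<exists>k R. R \<subseteq># line p u w A \<and> size R = 2 * k \<and> real (size R) \<le> \<rho> * real p \<and>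
      (\<forall>t. \<exists>B. B \<subseteq># R \<and> size B = k \<and> [lin v (sum_mset B) = t] (mod int p))"
    if p: "p \<ge> p0" "prime p" and A: "set_mset A \<subseteq> Zp2 p" "\<forall>x. real (count A x) \<le> \<delta> * real p"
      and det: "\<not> int p dvd det2 u v" and L: "\<eta> * real p \<le> size (line p u w A)" for p A u v w
  proof -
    let ?L = "line p u w A"
    have "real (size {#c \<in># image_mset (lin v) ?L. c mod int p = t#}) \<le> \<delta> * real p" for t
    proof (cases "{#a \<in># ?L. lin v a mod int p = t#} = {#}")
      case True
      then have empty: "size {#c \<in># image_mset (lin v) ?L. c mod int p = t#} = 0"
        unfolding filter_mset_image_mset by (simp only: size_image_mset size_empty)
      show ?thesis
        unfolding empty using \<delta> by simp
    next
      case False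
      then obtain x where x: "x \<in># {#a \<in># ?L. lin v a mod int p = t#}"
        by (meson multiset_nonemptyE)
      have "a = x" if a: "a \<in># {#a \<in># ?L. lin v a mod int p = t#}" for a
      proof -
        have "lin u a mod int p = lin u x mod int p" "lin v a mod int p = lin v x mod int p"
          using a x by (auto simp: line_def)
        then have "rep2 p a = rep2 p x"
          by (intro rep2_eqI[OF p(2) det]) (simp_all add: lin_diff mod_eq_dvd_iff)
        moreover have "a \<in> Zp2 p" "x \<in> Zp2 p"
          using a x A(1) by (auto simp: line_def)
        ultimately show ?thesis
          by (auto simp: rep2_def Zp2_def)
      qed
      then have "{#a \<in># ?L. lin v a mod int p = t#} \<subseteq># {#y \<in># A. y = x#}"
        by (intro mset_subset_eqI) (auto simp: line_def not_in_iff, metis count_eq_zero_iff)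
      then have "size {#a \<in># ?L. lin v a mod int p = t#} \<le> size {#y \<in># A. y = x#}"
        by (rule size_mset_mono)
      also have "\<dots> = count A x"
        by (simp add: filter_eq_replicate_mset)
      finally have "size {#a \<in># ?L. lin v a mod int p = t#} \<le> count A x" .
      moreover have "real (count A x) \<le> \<delta> * real p"
        using A(2) by blast
      ultimately show ?thesis
        by (simp add: filter_mset_image_mset)
    qed
    then obtain k R where R: "R \<subseteq># image_mset (lin v) ?L" "size R = 2 * k" "real (size R) \<le> \<rho> * real p"
      and sums: "\<And>t. \<exists>B. B \<subseteq># R \<and> size B = k \<and> [sum_mset B = t] (mod int p)"
      using cover[OF p, of "image_mset (lin v) ?L"] L by auto
    obtain R' where R': "R' \<subseteq># ?L" "image_mset (lin v) R' = R"
      using submset_image_mset_lift[OF R(1)] by blast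
    have "\<exists>B. B \<subseteq># R' \<and> size B = k \<and> [lin v (sum_mset B) = t] (mod int p)" for t
    proof -
      obtain B where B: "B \<subseteq># R" "size B = k" "[sum_mset B = t] (mod int p)"
        using sums by blast
      obtain B' where B': "B' \<subseteq># R'" "image_mset (lin v) B' = B"
        using submset_image_mset_lift B(1) R'(2) by metis
      have "sum_mset B = lin v (sum_mset B')"
        using B'(2) sum_mset_lin by blast
      then show ?thesis
        using B B' by (metis size_image_mset)
    qed
    moreover have "size R' = size R"
      using R'(2) by (metis size_image_mset)
    ultimately show ?thesis
      using R R'(1) by metis
  qed
  then show ?thesis
    using \<delta> by blast
qed

text \<open>Pad with arbitrary s - k elements outside R, then let R supply the negative of their
  sum. Outside R there are |A| - 2k elements, which explains s + k \<le> |A|.\<close>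

lemma full_cover_zero_sum:
  assumes R: "R \<subseteq># A" "size R = 2 * k"
    and sums: "\<And>t. \<exists>B. B \<subseteq># R \<and> size B = k \<and> rep2 p (sum_mset B) = rep2 p t"
    and s: "k \<le> s" "s + k \<le> size A"
  shows "\<exists>B. B \<subseteq># A \<and> size B = s \<and> zero_sum p B"
proof -
  have "s - k \<le> size (A - R)"
    using R s by (simp add: size_Diff_submset)
  then obtain D where D: "D \<subseteq># A - R" "size D = s - k"
    using exists_submset_of_size by blast
  obtain B where B: "B \<subseteq># R" "size B = k" "rep2 p (sum_mset B) = rep2 p (- sum_mset D)"
    using sums by blast
  have "R + D \<subseteq># A"
    using R(1) D(1) by (rule add_submset_diff)
  then have "B + D \<subseteq># A"
    using B(1) by (meson subset_mset.add_right_mono subset_mset.order_trans)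
  moreover have "size (B + D) = s"
    using B D s by simp
  moreover have "zero_sum p (B + D)"
    using B(3) unfolding zero_sum_iff_rep2 rep2_eq_iff by simp
  ultimately show ?thesis by blast
qed

lemma on_line_sum:
  assumes "\<forall>a\<in>#D. lin u a mod int p = w"
  shows "[lin u (sum_mset D) = int (size D) * w] (mod int p)"
  using assms
proof (induction D)
  case empty
  then show ?case by (simp add: lin_def)
next
  case (add a D)
  have "[lin u a = w] (mod int p)"
    using add.prems by (auto simp: cong_def)
  moreover have "[lin u (sum_mset D) = int (size D) * w] (mod int p)"
    using add by simp
  ultimately show ?case
    using cong_add by (fastforce simp: lin_add algebra_simps)
qed

text \<open>Replace k elements K of B on the line by k elements P of the reserve R on the same line.
  The value of \<open>u\<close> on the sum does not change modulo p, and P is chosen so that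
  \<open>v\<close> vanishes too. \<open>Q\<close> stands for all reserves together; B avoids it, so
  P and B - K can be united within A.\<close>

lemma swap_zero_sum:
  assumes p: "prime p" and det: "\<not> int p dvd det2 u v"
    and R: "R \<subseteq># Q" "Q \<subseteq># A" "R \<subseteq># line p u w A"
    and sums: "\<And>t. \<exists>B. B \<subseteq># R \<and> size B = k \<and> [lin v (sum_mset B) = t] (mod int p)"
    and B: "B \<subseteq># A - Q" "int p dvd lin u (sum_mset B)" "k \<le> size (line p u w B)"
  shows "\<exists>B'. B' \<subseteq># A \<and> size B' = size B \<and> zero_sum p B'"
proof -
  obtain K where K: "K \<subseteq># line p u w B" "size K = k"
    using exists_submset_of_size[OF B(3)] by blast
  have KB: "K \<subseteq># B"
    using K(1) line_subset subset_mset.order_trans by blast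
  obtain P where P: "P \<subseteq># R" "size P = k" "[lin v (sum_mset P) = - lin v (sum_mset (B - K))] (mod int p)"
    using sums by blast
  let ?B = "P + (B - K)"
  have "\<forall>a\<in>#P. lin u a mod int p = w"
    using mset_subset_eqD[OF P(1)] mset_subset_eqD[OF R(3)] by (auto simp: line_def)
  moreover have "\<forall>a\<in>#K. lin u a mod int p = w"
    using mset_subset_eqD[OF K(1)] by (auto simp: line_def)
  ultimately have PK: "[lin u (sum_mset P) = lin u (sum_mset K)] (mod int p)"
    using on_line_sum[of P] on_line_sum[of K] K(2) P(2) by (metis cong_sym cong_trans)
  have sumB: "sum_mset B = sum_mset K + sum_mset (B - K)"
    by (metis KB subset_mset.add_diff_inverse sum_mset.union)
  have "lin u (sum_mset ?B) = lin u (sum_mset B) + (lin u (sum_mset P) - lin u (sum_mset K))"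
    by (simp add: sumB lin_add)
  moreover have "int p dvd lin u (sum_mset P) - lin u (sum_mset K)"
    using PK by (simp add: cong_iff_dvd_diff)
  ultimately have du: "int p dvd lin u (sum_mset ?B - 0)"
    using B(2) by simp
  have dv: "int p dvd lin v (sum_mset ?B - 0)"
    using P(3) by (simp add: cong_iff_dvd_diff lin_add)
  have "zero_sum p ?B"
    unfolding zero_sum_iff_rep2 by (rule rep2_eqI[OF p det du dv])
  moreover have "?B \<subseteq># A"
  proof -
    have "B - K \<subseteq># A - Q"
      using B(1) by (meson diff_subset_eq_self subset_mset.order_trans)
    then have "Q + (B - K) \<subseteq># A"
      using R(2) by (intro add_submset_diff)
    moreover have "P \<subseteq># Q"
      using P(1) R(1) by (rule subset_mset.order_trans)
    ultimately show ?thesis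
      by (meson subset_mset.add_right_mono subset_mset.order_trans)
  qed
  moreover have "size ?B = size B"
    unfolding size_union size_Diff_submset[OF KB] using K(2) P(2) size_mset_mono[OF KB] by simp
  ultimately show ?thesis by blast
qed

section \<open>Counting along parallel lines and reduction to one linear form\<close>

lemma size_eq_sum_fibres:
  assumes "finite W" "\<And>b. b \<in># B \<Longrightarrow> g b \<in> W"
  shows "size B = (\<Sum>w\<in>W. size {#b \<in># B. g b = w#})"
  using assms(2)
proof (induction B)
  case empty
  then show ?case by simp
next
  case (add x B)
  have "(\<Sum>w\<in>W. size {#b \<in># add_mset x B. g b = w#})
    = (\<Sum>w\<in>W. size {#b \<in># B. g b = w#} + (if w = g x then 1 else 0))"
    by (intro sum.cong) auto
  also have "\<dots> = size B + 1"
    using add assms(1) by (simp add: sum.distrib)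
  finally show ?case by simp
qed

lemma sum_submset_of_fibres:
  assumes W: "finite W" and R: "\<And>w. w \<in> W \<Longrightarrow> R w \<subseteq># {#a \<in># A. g a = w#}"
  shows "(\<Sum>w\<in>W. R w) \<subseteq># A"
proof (rule mset_subset_eqI)
  fix x
  have zero: "count (R w) x = 0" if "w \<in> W" "w \<noteq> g x" for w
    using mset_subset_eq_count[OF R[OF that(1)], of x] that(2) by simp
  have "count (\<Sum>w\<in>W. R w) x = (\<Sum>w\<in>W. count (R w) x)"
    by (rule count_sum)
  also have "\<dots> = (\<Sum>w\<in>W. if w = g x then count (R w) x else 0)"
    using zero by (intro sum.cong) auto
  also have "\<dots> \<le> count A x"
    using W mset_subset_eq_count[OF R, of "g x" x] by (simp split: if_splits)
  finally show "count (\<Sum>w\<in>W. R w) x \<le> count A x" .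
qed

text \<open>Almost all of A is offered as C, and a sub-multiset of C of suitable size only has to
  annihilate one linear form; the second coordinate is repaired without changing the size. The upper
  bound 4p on the size of A limits the number of rich lines.\<close>

lemma reduction_to_linear_form:
  fixes e :: real
  assumes e: "0 < e" "e \<le> 1"
  shows "\<exists>\<delta>>0. \<exists>p0. \<forall>p\<ge>p0. prime p \<longrightarrow> (\<forall>A. set_mset A \<subseteq> Zp2 p \<and>
    (\<forall>x. real (count A x) \<le> \<delta> * real p) \<and> (1 + e) * real p \<le> size A \<and> real (size A) \<le> 4 * real p \<longrightarrow>
    (\<exists>C u. C \<subseteq># A \<and> real (size A) \<le> real (size C) + e / 2 * real p \<and>
      (\<forall>B. B \<subseteq># C \<and> int p dvd (\<Sum>b\<in>#B. lin u b) \<and> e / 8 * real p \<le> size B \<and> size B \<le> p \<longrightarrow>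
        (\<exists>B'. B' \<subseteq># A \<and> size B' = size B \<and> zero_sum p B'))))"
proof -
  have "e / 8 > 0"
    using e by simp
  then obtain \<eta>0 p1 where \<eta>0: "\<eta>0 > 0" and plane: "\<And>p (A :: (int \<times> int) multiset). p \<ge> p1 \<Longrightarrow> prime p \<Longrightarrow>
      e / 8 * real p \<le> size A \<Longrightarrow>
      (\<forall>u w. rep2 p u \<noteq> (0, 0) \<longrightarrow> real (size {#a \<in># A. lin u a mod int p = w#}) \<le> \<eta>0 * real p) \<Longrightarrow>
      (\<exists>k R. R \<subseteq># A \<and> size R = 2 * k \<and> real (size R) \<le> e / 8 * real p \<and>
        (\<forall>t. \<exists>B. B \<subseteq># R \<and> size B = k \<and> rep2 p (sum_mset B) = rep2 p t))"
    using plane_cover[of "e / 8"] by metis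
  define \<eta> where "\<eta> = min \<eta>0 1"
  have \<eta>: "\<eta> > 0" "\<eta> \<le> \<eta>0" "\<eta> \<le> 1"
    using \<eta>0 by (auto simp: \<eta>_def)
  \<comment> \<open>There will be at most 4 / \<eta> rich lines of one direction, so reserves of
    \<rho> p elements on each take at most e p / 8 together.\<close>
  define \<rho> where "\<rho> = e * \<eta> / 32"
  have \<rho>: "\<rho> > 0"
    using e \<eta> by (simp add: \<rho>_def)
  \<comment> \<open>Half the threshold: a rich line must still supply a reserve after the elements
    reserved on another line have been removed.\<close>
  have "\<eta> / 2 > 0"
    using \<eta> by simp
  then obtain \<delta> p2 where \<delta>: "\<delta> > 0" and line: "\<And>p A u v w. p \<ge> p2 \<Longrightarrow> prime p \<Longrightarrow>
      set_mset A \<subseteq> Zp2 p \<Longrightarrow> (\<forall>x. real (count A x) \<le> \<delta> * real p) \<Longrightarrow> \<not> int p dvd det2 u v \<Longrightarrow>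
      \<eta> / 2 * real p \<le> size (line p u w A) \<Longrightarrow>
      (\<exists>k R. R \<subseteq># line p u w A \<and> size R = 2 * k \<and> real (size R) \<le> \<rho> * real p \<and>
        (\<forall>t. \<exists>B. B \<subseteq># R \<and> size B = k \<and> [lin v (sum_mset B) = t] (mod int p)))"
    using line_cover[of "\<eta> / 2" \<rho>] \<rho> by metis
  have "\<exists>C u. C \<subseteq># A \<and> real (size A) \<le> real (size C) + e / 2 * real p \<and>
      (\<forall>B. B \<subseteq># C \<and> int p dvd (\<Sum>b\<in>#B. lin u b) \<and> e / 8 * real p \<le> size B \<and> size B \<le> p \<longrightarrow>
        (\<exists>B'. B' \<subseteq># A \<and> size B' = size B \<and> zero_sum p B'))"
    if pp: "p \<ge> max p1 p2" "prime p" and A: "set_mset A \<subseteq> Zp2 p" "\<forall>x. real (count A x) \<le> \<delta> * real p"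
      and sizeA: "(1 + e) * real p \<le> size A" "real (size A) \<le> 4 * real p" for p A
  proof -
    have p: "p > 0" "1 < p"
      using pp(2) prime_gt_0_nat prime_gt_1_nat by auto
    have p1: "p \<ge> p1" and p2: "p \<ge> p2"
      using pp by auto
    have ep: "0 < e * real p" "0 < \<eta> * real p"
      using e \<eta> p by auto
    have rp: "\<rho> * real p = e / 32 * (\<eta> * real p)"
      by (simp add: \<rho>_def)
    have "e / 32 * (\<eta> * real p) \<le> 1 / 32 * (\<eta> * real p)"
      using e ep by (intro mult_right_mono) auto
    then have rp1: "\<rho> * real p \<le> \<eta> / 2 * real p"
      using rp ep by linarith
    have "e / 32 * (\<eta> * real p) \<le> e / 32 * (1 * real p)"
      using \<eta> e by (intro mult_left_mono mult_right_mono) auto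
    then have rp2: "\<rho> * real p \<le> e / 32 * real p"
      unfolding rp by simp
    have full: ?thesis
      if R: "R \<subseteq># A" "size R = 2 * k" "real k \<le> e / 16 * real p"
        and sums: "\<And>t. \<exists>B. B \<subseteq># R \<and> size B = k \<and> rep2 p (sum_mset B) = rep2 p t" for R k
    \<comment> \<open>If fixed-length sums cover the plane, the zero form imposes no condition on B,
      and any admissible size is attained.\<close>
    proof (rule exI[of _ A], rule exI[of _ "(0, 0)"], intro conjI allI impI)
      show "real (size A) \<le> real (size A) + e / 2 * real p"
        using ep by simp
      fix B assume B: "B \<subseteq># A \<and> int p dvd (\<Sum>b\<in>#B. lin (0, 0) b) \<and> e / 8 * real p \<le> size B \<and> size B \<le> p"
      have "real k \<le> real (size B)"
        using R(3) B ep by linarith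
      then have k1: "k \<le> size B"
        by simp
      have "real (size B) \<le> real p"
        using B by simp
      then have "real (size B + k) \<le> real (size A)"
        using sizeA(1) R(3) ep by (simp add: algebra_simps)
      then have k2: "size B + k \<le> size A"
        by (simp only: of_nat_le_iff)
      show "\<exists>B'. B' \<subseteq># A \<and> size B' = size B \<and> zero_sum p B'"
        by (rule full_cover_zero_sum[OF R(1,2) sums k1 k2])
    qed simp
    define rich where "rich u w \<longleftrightarrow> rep2 p u \<noteq> (0, 0) \<and> \<eta> * real p \<le> size (line p u w A)" for u w
    show ?thesis
    proof (cases "\<exists>u w u' w'. rich u w \<and> rich u' w' \<and> \<not> int p dvd det2 u u'")
      case True
      then obtain u w u' w' where r: "rich u w" "rich u' w'" and det: "\<not> int p dvd det2 u u'"
        by blast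
      have "\<eta> / 2 * real p \<le> size (line p u w A)"
        using r(1) ep unfolding rich_def by linarith
      then obtain k R where R: "R \<subseteq># line p u w A" "size R = 2 * k" "real (size R) \<le> \<rho> * real p"
        and R_sums: "\<And>t. \<exists>B. B \<subseteq># R \<and> size B = k \<and> [lin u' (sum_mset B) = t] (mod int p)"
        using line[OF p2 pp(2) A det] by blast
      have RA: "R \<subseteq># A"
        using R(1) line_subset subset_mset.order_trans by blast
      have A': "set_mset (A - R) \<subseteq> Zp2 p" "\<forall>x. real (count (A - R) x) \<le> \<delta> * real p"
      proof -
        show "set_mset (A - R) \<subseteq> Zp2 p"
          using A(1) by (meson in_diffD subset_iff)
        show "\<forall>x. real (count (A - R) x) \<le> \<delta> * real p"
        proof
          fix x
          have "real (count (A - R) x) \<le> real (count A x)"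
            by simp
          then show "real (count (A - R) x) \<le> \<delta> * real p"
            using A(2) by (meson order_trans)
        qed
      qed
      have det': "\<not> int p dvd det2 u' u"
        using det by (metis det2_def dvd_minus_iff minus_diff_eq mult.commute)
      have "line p u' w' A = line p u' w' R + line p u' w' (A - R)"
        unfolding line_def by (metis RA filter_union_mset subset_mset.add_diff_inverse)
      then have "size (line p u' w' A) \<le> size R + size (line p u' w' (A - R))"
        using size_mset_mono[OF line_subset[of p u' w' R]] by simp
      then have "real (size (line p u' w' A)) \<le> real (size R) + real (size (line p u' w' (A - R)))"
        by (simp flip: of_nat_add)
      then have "\<eta> / 2 * real p \<le> size (line p u' w' (A - R))"
        using r(2) R(3) rp1 unfolding rich_def by linarith
      then obtain l Q where Q: "Q \<subseteq># line p u' w' (A - R)" "size Q = 2 * l" "real (size Q) \<le> \<rho> * real p"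
        and Q_sums: "\<And>t. \<exists>B. B \<subseteq># Q \<and> size B = l \<and> [lin u (sum_mset B) = t] (mod int p)"
        using line[OF p2 pp(2) A' det'] by blast
      have QA: "Q \<subseteq># A - R"
        using Q(1) line_subset subset_mset.order_trans by blast
      show ?thesis
      proof (rule full[of "R + Q" "k + l"])
        show "R + Q \<subseteq># A"
          using RA QA by (rule add_submset_diff)
        show "size (R + Q) = 2 * (k + l)"
          using R(2) Q(2) by simp
        have "2 * real k \<le> \<rho> * real p" "2 * real l \<le> \<rho> * real p"
          using R(2,3) Q(2,3) by auto
        then show "real (k + l) \<le> e / 16 * real p"
          using rp2 ep by simp
      next
        fix t :: "int \<times> int"
        \<comment> \<open>\<open>lin u\<close> is constant on the length-\<open>k\<close> sums of \<open>R\<close>, and \<open>lin u'\<close> on the length-\<open>l\<close> sums of \<open>Q\<close>, so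
          the two choices are made independently.\<close>
        have const: "[lin v (sum_mset D) = int (size D) * z] (mod int p)" if "D \<subseteq># line p v z M" for v z D M
          using on_line_sum[of D v p z] mset_subset_eqD[OF that] by (auto simp: line_def)
        obtain B where B: "B \<subseteq># R" "size B = k" "[lin u' (sum_mset B) = lin u' t - int l * w'] (mod int p)"
          using R_sums by blast
        obtain D where D: "D \<subseteq># Q" "size D = l" "[lin u (sum_mset D) = lin u t - int k * w] (mod int p)"
          using Q_sums by blast
        have "[lin u (sum_mset B) = int k * w] (mod int p)"
          using const[of B u w A] B(1,2) R(1) subset_mset.order_trans by blast
        then have "[lin u (sum_mset B) + lin u (sum_mset D) = int k * w + (lin u t - int k * w)] (mod int p)"
          using D(3) by (rule cong_add)
        then have du: "int p dvd lin u (sum_mset (B + D) - t)"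
          by (simp add: lin_diff lin_add cong_iff_dvd_diff)
        have "[lin u' (sum_mset D) = int l * w'] (mod int p)"
          using const[of D u' w' "A - R"] D(1,2) Q(1) subset_mset.order_trans by blast
        from cong_add[OF B(3) this] have du': "int p dvd lin u' (sum_mset (B + D) - t)"
          by (simp add: lin_diff lin_add cong_iff_dvd_diff)
        have "rep2 p (sum_mset (B + D)) = rep2 p t"
          by (rule rep2_eqI[OF pp(2) det du du'])
        moreover have "B + D \<subseteq># R + Q"
          using B(1) D(1) by (rule subset_mset.add_mono)
        ultimately show "\<exists>B. B \<subseteq># R + Q \<and> size B = k + l \<and> rep2 p (sum_mset B) = rep2 p t"
          using B(2) D(2) by (intro exI[of _ "B + D"]) simp
      qed
    next
      case False
      \<comment> \<open>Without rich lines any direction will do: \<open>W\<close> below is then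
        empty and \<open>A0\<close> is all of A.\<close>
      have "\<exists>u. rep2 p u \<noteq> (0, 0) \<and> (\<forall>u' w'. rich u' w' \<longrightarrow> int p dvd det2 u u')"
      proof (cases "\<exists>u w. rich u w")
        case True
        then show ?thesis
          using False unfolding rich_def by blast
      next
        case False
        moreover have "rep2 p (1, 0) \<noteq> (0, 0)"
          using p by (simp add: rep2_def)
        ultimately show ?thesis by blast
      qed
      then obtain u where u: "rep2 p u \<noteq> (0, 0)" and par: "\<And>u' w'. rich u' w' \<Longrightarrow> int p dvd det2 u u'"
        by blast
      obtain v where det: "\<not> int p dvd det2 u v"
        using exists_transversal[OF u] by blast
      define W where "W = {w \<in> {0..<int p}. \<eta> * real p \<le> size (line p u w A)}"
      have finW: "finite W"
        unfolding W_def by (rule finite_subset[of _ "{0..<int p}"]) auto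
      define A0 where "A0 = {#a \<in># A. lin u a mod int p \<notin> W#}"
      define A1 where "A1 = {#a \<in># A. lin u a mod int p \<in> W#}"
      have A01: "size A = size A0 + size A1"
        unfolding A0_def A1_def using multiset_partition[of A "\<lambda>a. lin u a mod int p \<in> W"]
        by (metis add.commute size_union)
      show ?thesis
      proof (cases "e / 8 * real p \<le> size A0")
        case True
        \<comment> \<open>A heavy fibre of \<open>u'\<close> inside \<open>A0\<close> would be part
          of a rich line, hence parallel to \<open>u\<close>. It would lie on one line of direction
          \<open>u\<close>, making that line rich, although \<open>A0\<close> avoids all of
          these.\<close>
        have "real (size {#a \<in># A0. lin u' a mod int p = w'#}) \<le> \<eta>0 * real p" if u': "rep2 p u' \<noteq> (0, 0)" for u' w'
        proof (rule ccontr)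
          let ?D = "{#a \<in># A0. lin u' a mod int p = w'#}"
          assume "\<not> ?thesis"
          moreover have "\<eta> * real p \<le> \<eta>0 * real p"
            using \<eta> by (intro mult_right_mono) auto
          ultimately have big: "\<eta> * real p < real (size ?D)"
            by linarith
          have "?D \<subseteq># line p u' w' A"
            unfolding line_def A0_def by (intro multiset_filter_mono) simp
          then have "size ?D \<le> size (line p u' w' A)"
            by (rule size_mset_mono)
          then have "rich u' w'"
            unfolding rich_def using u' big by simp
          then have dvd: "int p dvd det2 u u'"
            by (rule par)
          have "size ?D > 0"
            using big ep by (metis gr0I less_asym of_nat_0)
          then obtain x where x: "x \<in># ?D"
            by (metis multiset_nonemptyE nonempty_has_size)
          define z where "z = lin u x mod int p"
          have same: "lin u a mod int p = z" if "a \<in># ?D" for a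
          proof -
            have "lin u' a mod int p = lin u' x mod int p"
              using that x by simp
            then have "int p dvd lin u' (a - x)"
              by (simp add: lin_diff mod_eq_dvd_iff)
            then have "int p dvd lin u (a - x)"
              by (rule parallel_dvd[OF pp(2) dvd u'])
            then show ?thesis
              unfolding z_def by (simp add: lin_diff mod_eq_dvd_iff)
          qed
          have "?D \<subseteq># line p u z A"
          proof (rule mset_subset_eqI)
            fix a
            show "count ?D a \<le> count (line p u z A) a"
            proof (cases "a \<in># ?D")
              case True
              then show ?thesis
                using same[OF True] by (simp add: line_def A0_def)
            next
              case False
              then have "count ?D a = 0"
                by (simp only: not_in_iff)
              then show ?thesis
                by (simp only: le0)
            qed
          qed
          then have "size ?D \<le> size (line p u z A)"
            by (rule size_mset_mono)
          then have "\<eta> * real p \<le> size (line p u z A)"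
            using big by linarith
          then have "z \<in> W"
            unfolding W_def z_def using p by simp
          moreover have "z \<notin> W"
            using x unfolding A0_def z_def by simp
          ultimately show False
            by simp
        qed
        then obtain k R where R: "R \<subseteq># A0" "size R = 2 * k" "real (size R) \<le> e / 8 * real p"
          and sums: "\<And>t. \<exists>B. B \<subseteq># R \<and> size B = k \<and> rep2 p (sum_mset B) = rep2 p t"
          using plane[OF p1 pp(2) True] by blast
        have "R \<subseteq># A"
          using R(1) unfolding A0_def by (meson multiset_filter_subset subset_mset.order_trans)
        moreover have "real k \<le> e / 16 * real p"
          using R(2,3) by simp
        ultimately show ?thesis
          using full[of R k] R(2) sums by blast
      next
        case False
        have "\<forall>w\<in>W. \<exists>kR. snd kR \<subseteq># line p u w A \<and> size (snd kR) = 2 * fst kR \<and> real (size (snd kR)) \<le> \<rho> * real p \<and>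
          (\<forall>t. \<exists>B. B \<subseteq># snd kR \<and> size B = fst kR \<and> [lin v (sum_mset B) = t] (mod int p))"
        proof
          fix w assume "w \<in> W"
          then have "\<eta> * real p \<le> size (line p u w A)"
            by (simp add: W_def)
          then have "\<eta> / 2 * real p \<le> size (line p u w A)"
            using ep by linarith
          then obtain k R where "R \<subseteq># line p u w A \<and> size R = 2 * k \<and> real (size R) \<le> \<rho> * real p \<and>
            (\<forall>t. \<exists>B. B \<subseteq># R \<and> size B = k \<and> [lin v (sum_mset B) = t] (mod int p))"
            using line[OF p2 pp(2) A det] by blast
          then show "\<exists>kR. snd kR \<subseteq># line p u w A \<and> size (snd kR) = 2 * fst kR \<and> real (size (snd kR)) \<le> \<rho> * real p \<and>
            (\<forall>t. \<exists>B. B \<subseteq># snd kR \<and> size B = fst kR \<and> [lin v (sum_mset B) = t] (mod int p))"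
            by (intro exI[of _ "(k, R)"]) simp
        qed
        from bchoice[OF this] obtain kR where kR: "\<And>w. w \<in> W \<Longrightarrow> snd (kR w) \<subseteq># line p u w A \<and>
          size (snd (kR w)) = 2 * fst (kR w) \<and> real (size (snd (kR w))) \<le> \<rho> * real p \<and>
          (\<forall>t. \<exists>B. B \<subseteq># snd (kR w) \<and> size B = fst (kR w) \<and> [lin v (sum_mset B) = t] (mod int p))"
          by blast
        define Q where "Q = (\<Sum>w\<in>W. snd (kR w))"
        have QA: "Q \<subseteq># A1"
          unfolding Q_def
        proof (rule sum_submset_of_fibres[OF finW, where g = "\<lambda>a. lin u a mod int p"])
          fix w assume w: "w \<in> W"
          have "line p u w A \<subseteq># {#a \<in># A1. lin u a mod int p = w#}"
            unfolding line_def A1_def by (rule mset_subset_eqI) (use w in auto)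
          then show "snd (kR w) \<subseteq># {#a \<in># A1. lin u a mod int p = w#}"
            using kR[OF w] subset_mset.order_trans by blast
        qed
        have A1A: "A1 \<subseteq># A"
          unfolding A1_def by simp
        \<comment> \<open>The lines in question are disjoint and each has at least \<eta> p of at
          most 4p elements.\<close>
        have "(\<Sum>w\<in>W. \<eta> * real p) \<le> (\<Sum>w\<in>W. real (size (line p u w A)))"
          by (intro sum_mono) (simp add: W_def)
        also have "\<dots> = real (\<Sum>w\<in>W. size {#a \<in># A1. lin u a mod int p = w#})"
        proof -
          have "line p u w A = {#a \<in># A1. lin u a mod int p = w#}" if "w \<in> W" for w
            unfolding line_def A1_def by (rule multiset_eqI) (use that in auto)
          then show ?thesis
            by simp
        qed
        also have "(\<Sum>w\<in>W. size {#a \<in># A1. lin u a mod int p = w#}) = size A1"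
          by (rule size_eq_sum_fibres[symmetric]) (auto simp: finW A1_def)
        also have "real (size A1) \<le> 4 * real p"
          using sizeA(2) A01 by linarith
        finally have "real (card W) * (\<eta> * real p) \<le> 4 * real p"
          by simp
        then have cardW: "real (card W) * \<rho> * real p \<le> e / 8 * real p"
        proof -
          have "real (card W) * \<rho> * real p = e / 32 * (real (card W) * (\<eta> * real p))"
            by (simp add: \<rho>_def)
          also have "\<dots> \<le> e / 32 * (4 * real p)"
            using \<open>real (card W) * (\<eta> * real p) \<le> 4 * real p\<close> e by (intro mult_left_mono) auto
          finally show ?thesis by simp
        qed
        have "real (size Q) = (\<Sum>w\<in>W. real (size (snd (kR w))))"
          unfolding Q_def by (simp add: size_multiset_sum)
        also have "\<dots> \<le> (\<Sum>w\<in>W. \<rho> * real p)"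
          using kR by (intro sum_mono) blast
        finally have sizeQ: "real (size Q) \<le> e / 8 * real p"
          using cardW by simp
        show ?thesis
        proof (rule exI[of _ "A1 - Q"], rule exI[of _ u], intro conjI allI impI)
          show "A1 - Q \<subseteq># A"
            using A1A by (meson diff_subset_eq_self subset_mset.order_trans)
          have "size A1 = size (A1 - Q) + size Q"
            using QA size_mset_mono[OF QA] by (simp add: size_Diff_submset)
          then show "real (size A) \<le> real (size (A1 - Q)) + e / 2 * real p"
            using A01 False sizeQ ep by simp
        next
          fix B
          assume B: "B \<subseteq># A1 - Q \<and> int p dvd (\<Sum>b\<in>#B. lin u b) \<and> e / 8 * real p \<le> size B \<and> size B \<le> p"
          have inW: "lin u b mod int p \<in> W" if "b \<in># B" for b
          proof -
            have "b \<in># A1 - Q"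
              using B that by (meson mset_subset_eqD)
            then have "b \<in># A1"
              by (rule in_diffD)
            then show ?thesis
              by (simp add: A1_def)
          qed
          \<comment> \<open>Pigeonhole: if B had fewer elements than the swap length on every line,
            it would have at most e p / 16 elements, against the lower bound e p / 8.\<close>
          have "\<exists>w\<in>W. fst (kR w) \<le> size (line p u w B)"
          proof (rule ccontr)
            assume neg: "\<not> ?thesis"
            have "real (size B) = (\<Sum>w\<in>W. real (size (line p u w B)))"
              unfolding line_def by (subst size_eq_sum_fibres[OF finW inW]) auto
            also have "\<dots> \<le> (\<Sum>w\<in>W. \<rho> * real p / 2)"
            proof (rule sum_mono)
              fix w assume w: "w \<in> W"
              have "2 * real (fst (kR w)) \<le> \<rho> * real p"
                using kR[OF w] by simp
              moreover have "real (size (line p u w B)) \<le> real (fst (kR w))"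
                using neg w by auto
              ultimately show "real (size (line p u w B)) \<le> \<rho> * real p / 2"
                by linarith
            qed
            also have "\<dots> = real (card W) * \<rho> * real p / 2"
              by simp
            also have "\<dots> < e / 8 * real p"
              using cardW ep by linarith
            finally show False
              using B by linarith
          qed
          then obtain w where w: "w \<in> W" "fst (kR w) \<le> size (line p u w B)"
            by blast
          show "\<exists>B'. B' \<subseteq># A \<and> size B' = size B \<and> zero_sum p B'"
          proof (rule swap_zero_sum[OF pp(2) det])
            show "snd (kR w) \<subseteq># Q"
              unfolding Q_def using w(1) finW by (simp add: sum.remove)
            show "Q \<subseteq># A"
              using QA A1A by (rule subset_mset.order_trans)
            show "snd (kR w) \<subseteq># line p u w A"
              using kR[OF w(1)] by blast
            show "\<exists>B. B \<subseteq># snd (kR w) \<and> size B = fst (kR w) \<and> [lin v (sum_mset B) = t] (mod int p)" for t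
              using kR[OF w(1)] by blast
            have "A1 - Q \<subseteq># A - Q"
              by (rule mset_subset_eqI) (use mset_subset_eq_count[OF A1A] in \<open>simp add: diff_le_mono\<close>)
            then show "B \<subseteq># A - Q"
              using B subset_mset.order_trans by blast
            show "int p dvd lin u (sum_mset B)"
              using B by (simp add: sum_mset_lin)
            show "fst (kR w) \<le> size (line p u w B)"
              by (rule w(2))
          qed
        qed
      qed
    qed
  qed
  then show ?thesis
    using \<delta> by blast
qed

section \<open>Both assertions from the reduction and the one-dimensional zero-sum results\<close>

theorem theorem4:
  fixes \<epsilon> :: real
  assumes "\<epsilon> > 0"
  shows "\<exists>\<delta>::real. \<delta> > 0 \<and> (\<exists>p0::nat. \<forall>p::nat. prime p \<and> p \<ge> p0 \<longrightarrow>
    (\<forall>A :: (int \<times> int) multiset.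
       set_mset A \<subseteq> Zp2 p \<and> (\<forall>x. \<not> real (count A x) \<ge> \<delta> * real p) \<longrightarrow>
       (real (size A) > (1 + \<epsilon>) * real p \<longrightarrow>
          (\<exists>B. B \<subseteq># A \<and> B \<noteq> {#} \<and> size B \<le> p \<and> zero_sum p B)) \<and>
       (real (size A) > (2 + \<epsilon>) * real p \<longrightarrow>
          (\<exists>B. B \<subseteq># A \<and> size B = p \<and> zero_sum p B))))"
proof -
  define e where "e = min \<epsilon> 1"
  have e: "0 < e" "e \<le> 1" "e \<le> \<epsilon>"
    using assms by (auto simp: e_def)
  obtain \<delta> p0 where \<delta>: "\<delta> > 0" and reduce: "\<And>p A. p \<ge> p0 \<Longrightarrow> prime p \<Longrightarrow> set_mset A \<subseteq> Zp2 p \<Longrightarrow>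
    (\<forall>x. real (count A x) \<le> \<delta> * real p) \<Longrightarrow> (1 + e) * real p \<le> size A \<Longrightarrow> real (size A) \<le> 4 * real p \<Longrightarrow>
    (\<exists>C u. C \<subseteq># A \<and> real (size A) \<le> real (size C) + e / 2 * real p \<and>
      (\<forall>B. B \<subseteq># C \<and> int p dvd (\<Sum>b\<in>#B. lin u b) \<and> e / 8 * real p \<le> size B \<and> size B \<le> p \<longrightarrow>
        (\<exists>B'. B' \<subseteq># A \<and> size B' = size B \<and> zero_sum p B')))"
    using reduction_to_linear_form[OF e(1,2)] by metis
  have main: "\<exists>C u. real (c * p) + e / 2 * real p \<le> real (size C) \<and>
      (\<forall>B. B \<subseteq># C \<and> int p dvd (\<Sum>b\<in>#B. lin u b) \<and> e / 8 * real p \<le> size B \<and> size B \<le> p \<longrightarrow>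
        (\<exists>B'. B' \<subseteq># A \<and> size B' = size B \<and> zero_sum p B'))"
    if p: "prime p" "p \<ge> p0" and A: "set_mset A \<subseteq> Zp2 p" "\<forall>x. \<not> real (count A x) \<ge> \<delta> * real p"
      and c: "c = 1 \<or> c = 2" "real (size A) > (real c + \<epsilon>) * real p" for p A and c :: nat
  proof -
    have p0: "real p \<ge> 1"
      using p(1) prime_gt_0_nat[of p] by simp
    \<comment> \<open>A is cut down to about (c + e) p elements, with c = 1 or 2 for the two
      assertions. As e \<le> 1 this is at most 3p + 1 \<le> 4p, as the reduction demands.\<close>
    define n where "n = nat \<lceil>(real c + e) * real p\<rceil>"
    have "0 \<le> (real c + e) * real p"
      using e by simp
    then have n: "(real c + e) * real p \<le> real n" "real n \<le> (real c + e) * real p + 1"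
      unfolding n_def by linarith+
    have "(real c + e) * real p \<le> (real c + \<epsilon>) * real p"
      using e by (intro mult_right_mono) auto
    then have "(real c + e) * real p \<le> real (size A)"
      using c by linarith
    then have "n \<le> size A"
      unfolding n_def by (simp add: nat_le_iff ceiling_le_iff)
    then obtain A' where A': "A' \<subseteq># A" "size A' = n"
      using exists_submset_of_size by blast
    have "(1 + e) * real p \<le> (real c + e) * real p"
      using c by (intro mult_right_mono) auto
    then have lo: "(1 + e) * real p \<le> real (size A')"
      using n(1) A'(2) by simp
    have "(real c + e) * real p \<le> 3 * real p"
      using c e by (intro mult_right_mono) auto
    then have hi: "real (size A') \<le> 4 * real p"
      unfolding A'(2) using n(2) p0 by linarith
    have sub: "set_mset A' \<subseteq> Zp2 p"
      using A(1) set_mset_mono[OF A'(1)] by blast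
    have mult: "\<forall>x. real (count A' x) \<le> \<delta> * real p"
    proof
      fix x
      have "count A' x \<le> count A x"
        using A'(1) by (rule mset_subset_eq_count)
      then show "real (count A' x) \<le> \<delta> * real p"
        using A(2) by (meson le_less_trans less_imp_le not_le of_nat_le_iff)
    qed
    obtain C u where C: "real (size A') \<le> real (size C) + e / 2 * real p"
      and correct: "\<And>B. B \<subseteq># C \<Longrightarrow> int p dvd (\<Sum>b\<in>#B. lin u b) \<Longrightarrow> e / 8 * real p \<le> size B \<Longrightarrow> size B \<le> p \<Longrightarrow>
        (\<exists>B'. B' \<subseteq># A' \<and> size B' = size B \<and> zero_sum p B')"
      using reduce[OF p(2,1) sub mult lo hi] by blast
    have "real (c * p) + e / 2 * real p \<le> real (size C)"
      using C n(1) A'(2) by (simp add: algebra_simps)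
    moreover have "\<exists>B'. B' \<subseteq># A \<and> size B' = size B \<and> zero_sum p B'"
      if "B \<subseteq># C" "int p dvd (\<Sum>b\<in>#B. lin u b)" "e / 8 * real p \<le> size B" "size B \<le> p" for B
      using correct[OF that] A'(1) subset_mset.order_trans by blast
    ultimately show ?thesis
      by blast
  qed
  have part1: "\<exists>B. B \<subseteq># A \<and> B \<noteq> {#} \<and> size B \<le> p \<and> zero_sum p B"
    if p: "prime p" "p \<ge> p0" and A: "set_mset A \<subseteq> Zp2 p" "\<forall>x. \<not> real (count A x) \<ge> \<delta> * real p"
      "real (size A) > (1 + \<epsilon>) * real p" for p A
  proof -
    have p0: "p > 0"
      using p(1) by (rule prime_gt_0_nat)
    have ep: "0 < e * real p" "e * real p \<le> 1 * real p"
      using e p0 by (auto intro: mult_right_mono)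
    have "real (size A) > (real 1 + \<epsilon>) * real p"
      using A(3) by simp
    from main[OF p A(1,2) disjI1[OF refl] this] obtain C u where C: "real (1 * p) + e / 2 * real p \<le> real (size C)"
      and correct: "\<And>B. B \<subseteq># C \<Longrightarrow> int p dvd (\<Sum>b\<in>#B. lin u b) \<Longrightarrow> e / 8 * real p \<le> size B \<Longrightarrow> size B \<le> p \<Longrightarrow>
        (\<exists>B'. B' \<subseteq># A \<and> size B' = size B \<and> zero_sum p B')"
      by blast
    \<comment> \<open>A zero sum with more than m elements has at least e p / 8 of them, the length
      required for the correction; the surplus e p / 2 of C over p is enough to force one.\<close>
    define m where "m = nat \<lfloor>e / 8 * real p\<rfloor>"
    have m: "real m \<le> e / 8 * real p" "e / 8 * real p < real m + 1"
      unfolding m_def using ep by linarith+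
    have "real (2 * m) \<le> real p"
      using m ep by simp
    then have m1: "2 * m \<le> p"
      by (simp only: of_nat_le_iff)
    have "real (p + m) \<le> real (size C)"
      using m C ep by simp
    then have m2: "p + m \<le> size C"
      by (simp only: of_nat_le_iff)
    obtain B where B: "B \<subseteq># C" "m < size B" "size B \<le> p" "int p dvd (\<Sum>b\<in>#B. lin u b)"
      using exists_medium_zero_sum[OF p0 m1 m2] by blast
    have "e / 8 * real p \<le> size B"
      using m(2) B(2) by linarith
    then obtain B' where "B' \<subseteq># A" "size B' = size B" "zero_sum p B'"
      using correct[OF B(1,4)] B(3) by blast
    then show ?thesis
      using B(2,3) by (intro exI[of _ B']) auto
  qed
  have part2: "\<exists>B. B \<subseteq># A \<and> size B = p \<and> zero_sum p B"
    if p: "prime p" "p \<ge> p0" and A: "set_mset A \<subseteq> Zp2 p" "\<forall>x. \<not> real (count A x) \<ge> \<delta> * real p"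
      "real (size A) > (2 + \<epsilon>) * real p" for p A
  proof -
    have p0: "p > 0"
      using p(1) by (rule prime_gt_0_nat)
    have ep: "0 < e * real p" "e * real p \<le> 1 * real p"
      using e p0 by (auto intro: mult_right_mono)
    have "real (size A) > (real 2 + \<epsilon>) * real p"
      using A(3) by simp
    from main[OF p A(1,2) disjI2[OF refl] this] obtain C u where C: "real (2 * p) + e / 2 * real p \<le> real (size C)"
      and correct: "\<And>B. B \<subseteq># C \<Longrightarrow> int p dvd (\<Sum>b\<in>#B. lin u b) \<Longrightarrow> e / 8 * real p \<le> size B \<Longrightarrow> size B \<le> p \<Longrightarrow>
        (\<exists>B'. B' \<subseteq># A \<and> size B' = size B \<and> zero_sum p B')"
      by blast
    have "real (2 * p) \<le> real (size C)"
      using C ep by linarith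
    then have "2 * p - 1 \<le> size C"
      by linarith
    then obtain B where B: "B \<subseteq># C" "size B = p" "int p dvd (\<Sum>b\<in>#B. lin u b)"
      using erdos_ginzburg_ziv[OF p(1)] by blast
    moreover have "e / 8 * real p \<le> real p"
      using ep by linarith
    ultimately show ?thesis
      using correct[of B] by auto
  qed
  show ?thesis
    using \<delta> part1 part2 by blast
qed

end
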